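(* Let $q$ be a power of any prime. Let $\mu=(k^{m_k}(k-1)^{m_{k-1}}\cdots 2^{m_2}1^{m_1})$ be a partition of $n$ with largest part $k$, and let $l$ be an integer with $2\le l\le k$ and $m_l>0$. Suppose that the unipotent class of type $\mu$ of $\mathrm{U}(n,\mathbb{F}_q)$ is strongly real. Define the partition $\mu^{\#}$ by $$\mu^{\#}=\left((k-2)^{m_k}\cdots(l+1)^{m_{l+3}}\,l^{m_{l+2}}\,(l-1)^{m_{l-1}+m_{l+1}}\,(l-2)^{m_{l-2}+m_l}\,(l-3)^{m_{l-3}}\cdots\right)\quad\text{if } 3\le l<k,$$ $$\mu^{\#}=\left((k-2)^{m_k}\cdots 2^{m_4}\,1^{m_1+m_3}\right)\quad\text{if } l=2,$$ $$\mu^{\#}=\left((k-1)^{m_{k-1}}\,(k-2)^{m_{k-2}+m_k}\,(k-3)^{m_{k-3}}\cdots 1^{m_1}\right)\quad\text{if } l=k.$$ (That is, $\mu^{\#}$ is obtained from $\mu$ by subtracting $2$ from every part of size at least $l$.) Then the unipotent class of type $\mu^{\#}$ of $\mathrm{U}(n^{\#},\mathbb{F}_q)$, where $n^{\#}=n-2\sum_{l'\ge l}m_{l'}$, is strongly real.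
   Context: For a prime power $q$ write $\bar a=a^q$ for $a\in\mathbb{F}_{q^2}$, and apply the bar entrywise to matrices. The finite unitary group is $\mathrm{U}(n,\mathbb{F}_q)=\{g\in \mathrm{GL}(n,\mathbb{F}_{q^2}) : {}^{\top}\bar g\, g=I_n\}$ (trivial if $n=0$); up to isomorphism it is the isometry group of any non-degenerate Hermitian form on an $n$-dimensional $\mathbb{F}_{q^2}$-vector space. An element $g$ of a group $G$ is strongly real in $G$ if there is $s\in G$ with $s^2=1$ and $sgs=g^{-1}$; a class is strongly real if its elements are. Unipotent classes of $\mathrm{U}(n,\mathbb{F}_q)$ are parametrized by partitions of $n$: the unipotent class of type $\mu$ consists of the unipotent elements whose Jordan block sizes are the parts of $\mu$. The notation $(k^{m_k}\cdots 1^{m_1})$ means that the part $i$ has multiplicity $m_i\ge0$; set $m_i=0$ for $i>k$, and discard parts of size $0$. *)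

theory Defs
  imports
    "HOL-Algebra.Group"
    "HOL-Number_Theory.Prime_Powers"
    "HOL-Number_Theory.Residues"
    "HOL-Library.Multiset"
    "Jordan_Normal_Form.Jordan_Normal_Form"
begin

text \<open>
  Throughout, the field with $q^2$ elements is a type of class \<open>finite_field\<close> with
  \<open>card (UNIV :: 'a set) = q\<^sup>2\<close>; the number \<open>q\<close> is always passed explicitly, as it determines the bar.
\<close>

definition bar_mat :: "nat \<Rightarrow> 'a :: finite_field mat \<Rightarrow> 'a mat" where
  "bar_mat q A = map_mat (\<lambda>a. a ^ q) A"

definition unitary_group :: "nat \<Rightarrow> nat \<Rightarrow> 'a :: finite_field mat monoid" where
  "unitary_group q n = \<lparr>
     carrier = {g \<in> carrier_mat n n. invertible_mat g \<and>
                  transpose_mat (bar_mat q g) * g = 1\<^sub>m n},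
     mult = (*),
     one = 1\<^sub>m n\<rparr>"

lemma bar_add:
  fixes x y :: "'a :: finite_field"
  assumes "primepow q" "card (UNIV :: 'a set) = q\<^sup>2"
  shows "(x + y) ^ q = x ^ q + y ^ q"
proof -
  obtain p k where pk: "prime p" "q = p ^ k"
    using assms(1) by (auto simp: primepow_def)
  have "CHAR('a) dvd p ^ (k * 2)"
    using CHAR_dvd_CARD[where ?'a = 'a] assms(2) pk(2) by (simp add: power_mult)
  then have "CHAR('a) = p"
    using pk(1) CHAR_prime[where ?'a = 'a] prime_dvd_power primes_dvd_imp_eq by blast
  then show ?thesis
    using freshmans_dream'[of q k x y] pk by simp
qed

lemma bar_mat_carrier [simp]: "A \<in> carrier_mat m n \<Longrightarrow> bar_mat q A \<in> carrier_mat m n"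
  by (simp add: bar_mat_def)

lemma bar_mat_mult:
  fixes A B :: "'a :: finite_field mat"
  assumes "primepow q" "card (UNIV :: 'a set) = q\<^sup>2"
    and "A \<in> carrier_mat n n" "B \<in> carrier_mat n n"
  shows "bar_mat q (A * B) = bar_mat q A * bar_mat q B"
proof -
  have q: "q > 0"
    using assms(1) by (simp add: primepow_gt_0_nat)
  have sum: "(\<Sum>i \<in> S. f i) ^ q = (\<Sum>i \<in> S. f i ^ q)" for S :: "nat set" and f :: "nat \<Rightarrow> 'a"
    by (induction S rule: infinite_finite_induct)
      (use q in \<open>auto simp: bar_add[OF assms(1,2)] power_0_left\<close>)
  show ?thesis
    using assms(3,4)
    by (intro eq_matI) (auto simp: bar_mat_def scalar_prod_def sum power_mult_distrib)
qed

lemma invertible_matI: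
  fixes A B :: "'a :: field mat"
  assumes "A \<in> carrier_mat n n" "B \<in> carrier_mat n n" "B * A = 1\<^sub>m n"
  shows "invertible_mat A"
  using assms mat_mult_left_right_inverse[OF assms(2,1,3)]
  by (auto simp: invertible_mat_def inverts_mat_def)

lemma group_unitary_group:
  assumes "primepow q" "card (UNIV :: 'a :: finite_field set) = q\<^sup>2"
  shows "group (unitary_group q n :: 'a mat monoid)" (is "group ?U")
proof -
  have q: "q > 0"
    using assms(1) by (simp add: primepow_gt_0_nat)
  have bar_one: "bar_mat q (1\<^sub>m n :: 'a mat) = 1\<^sub>m n"
    using q by (intro eq_matI) (auto simp: bar_mat_def power_0_left)
  have mem: "g \<in> carrier ?U \<longleftrightarrow> g \<in> carrier_mat n n \<and> transpose_mat (bar_mat q g) * g = 1\<^sub>m n" for g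
    using invertible_matI[of g n "transpose_mat (bar_mat q g)"]
    by (auto simp: unitary_group_def)
  have ops: "x \<otimes>\<^bsub>?U\<^esub> y = x * y" "\<one>\<^bsub>?U\<^esub> = 1\<^sub>m n" for x y
    by (auto simp: unitary_group_def)
  show ?thesis
  proof (rule groupI, unfold ops)
    fix x y assume "x \<in> carrier ?U" "y \<in> carrier ?U"
    then have x: "x \<in> carrier_mat n n" "transpose_mat (bar_mat q x) * x = 1\<^sub>m n"
      and y: "y \<in> carrier_mat n n" "transpose_mat (bar_mat q y) * y = 1\<^sub>m n"
      by (auto simp: mem)
    let ?X = "transpose_mat (bar_mat q x)" and ?Y = "transpose_mat (bar_mat q y)"
    have X: "?X \<in> carrier_mat n n" and Y: "?Y \<in> carrier_mat n n"
      using x y by auto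
    have "transpose_mat (bar_mat q (x * y)) * (x * y) = (?Y * ?X) * (x * y)"
      using x y by (simp add: bar_mat_mult[OF assms] transpose_mult[of _ n n _ n])
    also have "\<dots> = ?Y * ((?X * x) * y)"
      using x(1) y(1) X Y by (simp add: assoc_mult_mat[of _ n n _ n _ n])
    also have "\<dots> = 1\<^sub>m n"
      using x y Y by simp
    finally show "x * y \<in> carrier ?U"
      using x y by (simp add: mem)
  next
    show "1\<^sub>m n \<in> carrier ?U"
      by (simp add: mem bar_one)
  next
    fix x y z assume "x \<in> carrier ?U" "y \<in> carrier ?U" "z \<in> carrier ?U"
    then show "x * y * z = x * (y * z)"
      by (auto simp: mem assoc_mult_mat[of _ n n _ n _ n])
  next
    fix x assume "x \<in> carrier ?U"
    then show "1\<^sub>m n * x = x" by (auto simp: mem)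
  next
    fix x assume "x \<in> carrier ?U"
    then have x: "x \<in> carrier_mat n n" "transpose_mat (bar_mat q x) * x = 1\<^sub>m n"
      by (auto simp: mem)
    let ?X = "transpose_mat (bar_mat q x)"
    have X: "?X \<in> carrier_mat n n" using x by auto
    have xX: "x * ?X = 1\<^sub>m n"
      using mat_mult_left_right_inverse[OF X x(1) x(2)] .
    have q2: "a ^ (q * q) = a" for a :: 'a
      using finite_field_power_card_eq_same[of a] assms(2) by (simp add: power2_eq_square)
    have "transpose_mat (bar_mat q ?X) = x"
      using x(1) by (intro eq_matI) (auto simp: bar_mat_def q2 simp flip: power_mult)
    then have "?X \<in> carrier ?U"
      using X xX by (simp add: mem)
    then show "\<exists>y \<in> carrier ?U. y * x = 1\<^sub>m n"
      using x(2) by blast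
  qed
qed

definition strongly_real :: "('g, 'b) monoid_scheme \<Rightarrow> 'g \<Rightarrow> bool" where
  "strongly_real G g \<longleftrightarrow> g \<in> carrier G \<and>
     (\<exists>s \<in> carrier G. s \<otimes>\<^bsub>G\<^esub> s = \<one>\<^bsub>G\<^esub> \<and> s \<otimes>\<^bsub>G\<^esub> g \<otimes>\<^bsub>G\<^esub> s = inv\<^bsub>G\<^esub> g)"

definition is_conjugacy_class :: "('g, 'b) monoid_scheme \<Rightarrow> 'g set \<Rightarrow> bool" where
  "is_conjugacy_class G C \<longleftrightarrow>
     (\<exists>g \<in> carrier G. C = {h \<otimes>\<^bsub>G\<^esub> g \<otimes>\<^bsub>G\<^esub> inv\<^bsub>G\<^esub> h | h. h \<in> carrier G})"

definition strongly_real_class :: "('g, 'b) monoid_scheme \<Rightarrow> 'g set \<Rightarrow> bool" where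
  "strongly_real_class G C \<longleftrightarrow> is_conjugacy_class G C \<and> (\<forall>g \<in> C. strongly_real G g)"

definition unipotent_mat :: "nat \<Rightarrow> 'a :: field mat \<Rightarrow> bool" where
  "unipotent_mat n g \<longleftrightarrow> (\<exists>r. (g - 1\<^sub>m n) ^\<^sub>m r = 0\<^sub>m n n)"

text \<open>
  Partitions are multisets of positive natural numbers, so that \<open>count \<mu> i\<close> is the
  multiplicity $m_i$ of the part \<open>i\<close>.
\<close>

definition is_partition :: "nat \<Rightarrow> nat multiset \<Rightarrow> bool" where
  "is_partition n \<mu> \<longleftrightarrow> 0 \<notin># \<mu> \<and> sum_mset \<mu> = n"

definition unipotent_class :: "nat \<Rightarrow> nat \<Rightarrow> nat multiset \<Rightarrow> 'a :: finite_field mat set" where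
  "unipotent_class q n \<mu> = {g \<in> carrier (unitary_group q n). unipotent_mat n g \<and>
     (\<exists>n_as. jordan_nf g n_as \<and> image_mset fst (mset n_as) = \<mu>)}"

text \<open>
  The partition $\mu^{\#}$: subtract 2 from every part of size at least \<open>l\<close> and discard the
  parts that become 0. The lemmas \<open>count_partition_sharp_middle\<close>, \<open>count_partition_sharp_two\<close>
  and \<open>count_partition_sharp_top\<close> below give the multiplicities in the cases
  $3 \le l < k$, $l = 2$ and $l = k$.
\<close>

definition partition_sharp :: "nat \<Rightarrow> nat multiset \<Rightarrow> nat multiset" where
  "partition_sharp l \<mu> =
     filter_mset (\<lambda>i. 0 < i) (image_mset (\<lambda>i. if l \<le> i then i - 2 else i) \<mu>)"

lemma count_partition_sharp:
  assumes "2 \<le> l" "0 < i"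
  shows "count (partition_sharp l \<mu>) i =
           (if i < l then count \<mu> i else 0) + (if l \<le> i + 2 then count \<mu> (i + 2) else 0)"
  using assms by (induction \<mu>) (auto simp: partition_sharp_def)

lemma count_partition_sharp_zero: "count (partition_sharp l \<mu>) 0 = 0"
  by (simp add: partition_sharp_def)

lemma count_partition_sharp_middle:
  assumes "3 \<le> l" "0 < i"
  shows "count (partition_sharp l \<mu>) i =
          (if l \<le> i then count \<mu> (i + 2)
           else if i = l - 1 then count \<mu> (l - 1) + count \<mu> (l + 1)
           else if i = l - 2 then count \<mu> (l - 2) + count \<mu> l
           else count \<mu> i)"
proof -
  have "i + 2 = l + 1" if "i = l - 1" using that assms by simp
  moreover have "i + 2 = l" if "i = l - 2" using that assms by simp
  ultimately show ?thesis
    using assms by (auto simp: count_partition_sharp)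
qed

lemma count_partition_sharp_two:
  assumes "0 < i"
  shows "count (partition_sharp 2 \<mu>) i =
          (if i = 1 then count \<mu> 1 + count \<mu> 3 else count \<mu> (i + 2))"
  using assms by (auto simp: count_partition_sharp numeral_3_eq_3)

lemma count_partition_sharp_top:
  assumes "2 \<le> k" "\<forall>i \<in># \<mu>. i \<le> k" "0 < i"
  shows "count (partition_sharp k \<mu>) i =
          (if k \<le> i then 0
           else if i = k - 2 then count \<mu> (k - 2) + count \<mu> k
           else count \<mu> i)"
proof -
  have "count \<mu> j = 0" if "k < j" for j
    using assms(2) that by (meson count_eq_zero_iff leD)
  moreover have "i + 2 = k" if "i = k - 2" using that assms by simp
  ultimately show ?thesis
    using assms by (auto simp: count_partition_sharp)
qed

lemma is_partition_sharp:
  assumes "2 \<le> l" "is_partition n \<mu>" "\<forall>i \<in># \<mu>. i \<le> k"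
  shows "is_partition (n - 2 * (\<Sum>i = l..k. count \<mu> i)) (partition_sharp l \<mu>)"
proof -
  have "sum_mset (partition_sharp l \<mu>) + 2 * (\<Sum>i = l..k. count \<mu> i) = sum_mset \<mu>"
    using assms(3)
  proof (induction \<mu>)
    case (add x \<mu>)
    have "(\<Sum>i = l..k. count (add_mset x \<mu>) i) =
            (\<Sum>i = l..k. count \<mu> i + (if i = x then 1 else 0))"
      by (intro sum.cong) auto
    also have "\<dots> = (\<Sum>i = l..k. count \<mu> i) + (if l \<le> x then 1 else 0)"
      using add.prems by (auto simp: sum.distrib)
    finally show ?case
      using add assms(1) by (auto simp: partition_sharp_def)
  qed (simp add: partition_sharp_def)
  then show ?thesis
    using assms(2) by (auto simp: is_partition_def count_partition_sharp_zero
        simp flip: count_greater_zero_iff)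
qed

end

theory Submission
  imports Defs "HOL-Algebra.RingHom"
begin

text \<open>Let \<open>g\<close> be unipotent of type \<open>\<mu>\<close> on a Hermitian space $V$, let $N = g - 1$, and suppose that
  the involution \<open>s\<close> inverts \<open>g\<close>. The subspace $A = \ker N \cap \mathrm{im}\, N^{l-1}$ has one dimension
  for each Jordan block of size at least \<open>l\<close>. Since $(\mathrm{im}\, N)^\perp = \ker N$ and \<open>l \<ge> 2\<close>, it is
  totally isotropic, with $A^\perp = \mathrm{im}\, N + \ker N^{l-1}$. Passing to $A^\perp/A$ removes the first
  and the last basis vector of every block of size at least \<open>l\<close> and keeps the other blocks, so \<open>g\<close> acts
  there with type $\mu^{\#}$. As \<open>s\<close> conjugates \<open>g\<close> to its inverse, it preserves $A$ and $A^\perp$ and acts on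
  the non-degenerate Hermitian space $A^\perp/A$ as an involution that inverts the image of \<open>g\<close>.

  In matrices, $A^\perp/A$ is the middle layer of a Jordan basis and the action on it is the
  compression $X \mapsto P^\top X P$ of the locale \<open>core_compression\<close>. One lemma,
  \<open>intertwiner_preserves_socle\<close>, supplies all the vanishing blocks that make compression
  multiplicative: it applies to \<open>s\<close>, to the Gram matrix of the form and to the inverse of the Gram matrix.
  Compression is then carried out for Jordan matrices in \<open>ex_core_compression\<close>.

  Two facts about Hermitian forms over finite fields remain. The compressed Gram matrix has to be
  brought back to the identity, and one strongly real element of type $\mu^{\#}$ has to yield the
  whole class, that is, unitary matrices that are similar have to be conjugate in the unitary group. Both follow
  from \<open>hermitian_eq_adjoint_mult\<close>: an invertible Hermitian \<open>H\<close> is \<open>adjoint q y * y\<close> for some \<open>y\<close> that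
  commutes with everything that commutes with \<open>H\<close>. This is an instance of Lang's theorem, but it has
  an elementary proof. The matrices that commute with the centralizer of \<open>H\<close> form a finite commutative ring on
  which the adjoint is an involution, and a version of Hilbert's Theorem 90 for such rings turns, by
  counting, into the surjectivity of the norm map onto the self-adjoint units (\<open>norm_surjective\<close>).\<close>

section \<open>The norm map of a finite commutative ring with involution\<close>

lemma (in cring) finite_idempotent_power:
  assumes fin: "finite (carrier R)" and x: "x \<in> carrier R"
  obtains M :: nat where "M > 0" "x [^] M \<otimes> x [^] M = x [^] M"
proof -
  have "finite (range (\<lambda>k::nat. x [^] k))"
    by (rule finite_subset[OF _ fin]) (use x in auto)
  then have "\<not> inj (\<lambda>k::nat. x [^] k)"
    using finite_imageD infinite_UNIV_nat by blast
  then obtain a b :: nat where ab: "a < b" "x [^] a = x [^] b"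
    unfolding inj_def by (metis linorder_neq_iff)
  define d where "d = b - a"
  have per: "x [^] (k + d) = x [^] k" if "a \<le> k" for k
  proof -
    have "x [^] (k + d) = x [^] b \<otimes> x [^] (k - a)"
      using ab(1) that x by (simp add: nat_pow_mult d_def add.commute)
    also have "\<dots> = x [^] k"
      using that x by (simp add: nat_pow_mult flip: ab(2))
    finally show ?thesis .
  qed
  have per': "x [^] (k + d * j) = x [^] k" if "a \<le> k" for k j
  proof (induction j)
    case (Suc j)
    have "x [^] (k + d * Suc j) = x [^] (k + d * j + d)" by (simp add: algebra_simps)
    with Suc per[of "k + d * j"] that show ?case by simp
  qed simp
  \<comment> \<open>the multiple \<open>d * (a + 1)\<close> of the period lies beyond the preperiod, so doubling it changes nothing\<close>
  have "d > 0" using ab by (simp add: d_def)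
  then have "a \<le> d * (a + 1)"
    by (metis One_nat_def Suc_leI add.commute le_add2 mult_le_mono1 nat_mult_1 order_trans)
  from per'[OF this, of "a + 1"] have "x [^] (d * (a + 1)) \<otimes> x [^] (d * (a + 1)) = x [^] (d * (a + 1))"
    using x by (simp add: nat_pow_mult)
  with \<open>d > 0\<close> show thesis by (intro that[of "d * (a + 1)"]) auto
qed

text \<open>Multiplication by a regular element is injective, hence surjective on a finite ring.\<close>

lemma (in cring) finite_regular_Unit:
  assumes fin: "finite (carrier R)" and z: "z \<in> carrier R"
    and regular: "\<And>t. t \<in> carrier R \<Longrightarrow> z \<otimes> t = \<zero> \<Longrightarrow> t = \<zero>"
  shows "z \<in> Units R"
proof -
  have "inj_on (\<lambda>t. z \<otimes> t) (carrier R)"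
  proof (rule inj_onI)
    fix s t assume st: "s \<in> carrier R" "t \<in> carrier R" "z \<otimes> s = z \<otimes> t"
    have "z \<otimes> (s \<ominus> t) = z \<otimes> s \<ominus> z \<otimes> t" using z st(1,2) by algebra
    also have "\<dots> = \<zero>" using z st by simp
    finally have "s \<ominus> t = \<zero>" using regular st by blast
    then show "s = t" using st r_right_minus_eq by blast
  qed
  then have "(\<lambda>t. z \<otimes> t) ` carrier R = carrier R"
    using fin z by (intro endo_inj_surj) auto
  then obtain t where "t \<in> carrier R" "z \<otimes> t = \<one>"
    by (metis imageE one_closed)
  then show ?thesis using z m_comm by (auto simp: Units_def)
qed

text \<open>The fibres of a homomorphism are cosets of its kernel.\<close>

lemma (in group_hom) card_kernel_image:
  assumes "finite (carrier G)"
  shows "card (carrier G) = card (kernel G H h) * card (h ` carrier G)"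
proof -
  have fiber: "card {x \<in> carrier G. h x = h a} = card (kernel G H h)" if a: "a \<in> carrier G" for a
  proof -
    have "bij_betw (\<lambda>k. a \<otimes> k) (kernel G H h) {x \<in> carrier G. h x = h a}"
    proof (rule bij_betw_byWitness[where f' = "\<lambda>x. inv a \<otimes> x"])
      show "\<forall>k\<in>kernel G H h. inv a \<otimes> (a \<otimes> k) = k"
        using a by (auto simp: kernel_def simp flip: G.m_assoc)
      show "\<forall>x\<in>{x \<in> carrier G. h x = h a}. a \<otimes> (inv a \<otimes> x) = x"
        using a by (auto simp flip: G.m_assoc)
    qed (use a in \<open>auto simp: kernel_def\<close>)
    then show ?thesis by (simp add: bij_betw_same_card)
  qed
  have "card (carrier G) = (\<Sum>b\<in>h ` carrier G. card {x \<in> carrier G. h x = b})"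
    using sum.image_gen[OF assms, of "\<lambda>_. 1::nat" h] by simp
  also have "\<dots> = (\<Sum>b\<in>h ` carrier G. card (kernel G H h))"
    by (rule sum.cong) (auto simp: fiber)
  finally show ?thesis by simp
qed

text \<open>For a field, the last assumption says that \<open>\<sigma>\<close> moves \<open>lam\<close>. Asking for a unit makes the difference
  \<open>lam \<ominus> \<sigma> lam\<close> nonzero modulo every maximal ideal. It thus excludes ramification, also in
  residue characteristic 2; for ramified extensions the norm map can fail to be surjective.\<close>

locale finite_involutive_cring = cring +
  fixes \<sigma> lam
  assumes finite_carrier: "finite (carrier R)"
    and hom: "\<sigma> \<in> Ring.ring_hom R R"
    and involutive: "\<And>x. x \<in> carrier R \<Longrightarrow> \<sigma> (\<sigma> x) = x"
    and lam: "lam \<in> carrier R" "lam \<ominus> \<sigma> lam \<in> Units R"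
begin

lemma sigma_simps [simp]:
  shows "x \<in> carrier R \<Longrightarrow> \<sigma> x \<in> carrier R"
    and "x \<in> carrier R \<Longrightarrow> y \<in> carrier R \<Longrightarrow> \<sigma> (x \<otimes> y) = \<sigma> x \<otimes> \<sigma> y"
    and "x \<in> carrier R \<Longrightarrow> y \<in> carrier R \<Longrightarrow> \<sigma> (x \<oplus> y) = \<sigma> x \<oplus> \<sigma> y"
    and "\<sigma> \<one> = \<one>"
  using hom by (auto simp: Ring.ring_hom_def)

lemma sigma_pow: "x \<in> carrier R \<Longrightarrow> \<sigma> (x [^] (k::nat)) = \<sigma> x [^] k"
  by (induction k) auto

lemma sigma_Units: "x \<in> Units R \<Longrightarrow> \<sigma> x \<in> Units R"
  unfolding Units_def by (smt (verit, best) mem_Collect_eq sigma_simps(1) sigma_simps(2) sigma_simps(4))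

text \<open>Every \<open>z = w \<oplus> y \<otimes> \<sigma> w\<close> satisfies \<open>z = y \<otimes> \<sigma> z\<close>, so the point is to choose \<open>w\<close> such that \<open>z\<close>
  is a unit. The choice \<open>w = \<one>\<close> gives \<open>x = \<one> \<oplus> y\<close>, which is good on the part of the ring where
  \<open>x\<close> is invertible. On the complementary part \<open>x\<close> is nilpotent, so \<open>y\<close> is congruent to
  \<open>\<ominus> \<one>\<close>, and there \<open>w = lam\<close> gives \<open>lam \<ominus> \<sigma> lam\<close> up to a nilpotent. An idempotent power \<open>e\<close> of \<open>x\<close>
  splits the ring into these two parts, and it is fixed by \<open>\<sigma>\<close>, because \<open>x\<close> and \<open>\<sigma> x\<close> are associated.\<close>

lemma hilbert_90:
  assumes y: "y \<in> carrier R" "y \<otimes> \<sigma> y = \<one>"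
  obtains z where "z \<in> Units R" "z = y \<otimes> \<sigma> z"
proof -
  interpret \<sigma>: ring_hom_ring R R \<sigma>
    using hom by (simp add: ring_hom_ringI2 ring_axioms)
  define x where "x = \<one> \<oplus> y"
  have x: "x \<in> carrier R" using y by (simp add: x_def)
  obtain M :: nat where M: "M > 0" "x [^] M \<otimes> x [^] M = x [^] M"
    using finite_idempotent_power[OF finite_carrier x] .
  define e where "e = x [^] M"
  have e: "e \<in> carrier R" "e \<otimes> e = e" using x M by (auto simp: e_def)
  have "\<sigma> x = \<sigma> y \<otimes> x"
  proof -
    have "\<sigma> y \<otimes> x = \<sigma> y \<oplus> y \<otimes> \<sigma> y" using y(1) unfolding x_def by (simp add: r_distr m_comm)
    then show ?thesis using y by (simp add: x_def a_comm)
  qed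
  then have se: "\<sigma> e = \<sigma> y [^] M \<otimes> e"
    using x y by (simp add: e_def sigma_pow nat_pow_distrib)
  have "\<sigma> e \<otimes> e = \<sigma> y [^] M \<otimes> (e \<otimes> e)"
    using se e(1) y(1) by (simp add: m_assoc)
  then have see: "\<sigma> e \<otimes> e = \<sigma> e" using se e by simp
  have "\<sigma> (\<sigma> e \<otimes> e) = e \<otimes> \<sigma> e" using e by (simp add: involutive)
  then have sigma_e: "\<sigma> e = e" using see e by (simp add: involutive m_comm)
  define f where "f = \<one> \<ominus> e"
  have f: "f \<in> carrier R" "f \<otimes> e = \<zero>" "f \<otimes> f = f" "e \<oplus> f = \<one>"
  proof -
    show f1: "f \<in> carrier R" using e by (simp add: f_def)
    have "f \<otimes> e = e \<ominus> e \<otimes> e" unfolding f_def using e(1) by algebra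
    then show fe: "f \<otimes> e = \<zero>" using e by simp
    have "f \<otimes> f = f \<ominus> f \<otimes> e" using e(1) f1 unfolding f_def by algebra
    then show "f \<otimes> f = f" using fe e(1) f1 by (simp add: minus_eq)
    show "e \<oplus> f = \<one>" unfolding f_def using e(1) by algebra
  qed
  have sigma_f: "\<sigma> f = f" unfolding f_def minus_eq using e(1) by (simp add: sigma_e)
  \<comment> \<open>the witness that equals \<open>\<one>\<close> on the part \<open>e\<close> and \<open>lam\<close> on the part \<open>f\<close>\<close>
  define w where "w = e \<oplus> f \<otimes> lam"
  define z where "z = w \<oplus> y \<otimes> \<sigma> w"
  have w: "w \<in> carrier R" using e f lam by (simp add: w_def)
  have z: "z \<in> carrier R" using w y by (simp add: z_def)
  have "y \<otimes> \<sigma> z = y \<otimes> \<sigma> w \<oplus> (y \<otimes> \<sigma> y) \<otimes> w"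
    using w y(1) by (simp add: z_def involutive r_distr m_assoc)
  then have yz: "z = y \<otimes> \<sigma> z"
    using w y by (simp add: z_def a_comm)
  let ?s = "\<sigma> lam"
  have dist: "a \<otimes> (e \<oplus> f \<otimes> lam \<oplus> y \<otimes> (e \<oplus> f \<otimes> s)) =
      (a \<otimes> e \<oplus> (a \<otimes> f) \<otimes> lam) \<oplus> y \<otimes> (a \<otimes> e \<oplus> (a \<otimes> f) \<otimes> s)"
    if "a \<in> carrier R" "s \<in> carrier R" for a s
    using that e(1) f(1) lam(1) y(1) by (simp add: r_distr m_ac)
  have z_eq: "z = e \<oplus> f \<otimes> lam \<oplus> y \<otimes> (e \<oplus> f \<otimes> ?s)"
    unfolding z_def w_def using e(1) f(1) lam(1) by (simp add: sigma_e sigma_f)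
  have ef: "e \<otimes> f = \<zero>" using f e(1) by (simp add: m_comm)
  have ez: "e \<otimes> z = e \<otimes> x"
    unfolding z_eq using e f ef lam(1) y(1) by (subst dist) (auto simp: x_def r_distr m_comm)
  have fz: "f \<otimes> z = f \<otimes> ((lam \<ominus> ?s) \<oplus> x \<otimes> ?s)"
  proof -
    have "f \<otimes> z = f \<otimes> lam \<oplus> y \<otimes> (f \<otimes> ?s)"
      unfolding z_eq using e f lam(1) y(1) by (subst dist) auto
    also have "\<dots> = f \<otimes> (lam \<oplus> y \<otimes> ?s)"
      using f(1) lam(1) y(1) by (simp add: r_distr m_lcomm)
    also have "lam \<oplus> y \<otimes> ?s = (lam \<ominus> ?s) \<oplus> x \<otimes> ?s"
    proof -
      have "lam \<oplus> y \<otimes> s = (lam \<ominus> s) \<oplus> (\<one> \<oplus> y) \<otimes> s" if "s \<in> carrier R" for s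
        using that lam(1) y(1) by algebra
      then show ?thesis using lam(1) by (simp add: x_def)
    qed
    finally show ?thesis .
  qed
  have "z \<in> Units R"
  proof (rule finite_regular_Unit[OF finite_carrier z])
    fix t assume t: "t \<in> carrier R" "z \<otimes> t = \<zero>"
    have "e \<otimes> x \<otimes> t = e \<otimes> (z \<otimes> t)" using ez e z t(1) by (simp flip: m_assoc)
    then have ext: "e \<otimes> x \<otimes> t = \<zero>" using t e by simp
    obtain m where m: "M = Suc m" using M(1) gr0_implies_Suc by blast
    have "e \<otimes> t = (e \<otimes> e) \<otimes> t" using e by simp
    also have "\<dots> = (e \<otimes> (x [^] m \<otimes> x)) \<otimes> t"
      using m by (simp add: e_def)
    also have "\<dots> = x [^] m \<otimes> (e \<otimes> x \<otimes> t)"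
      using e(1) x t(1) by (simp add: m_ac)
    finally have et: "e \<otimes> t = \<zero>" using ext x by simp
    have "t = (e \<oplus> f) \<otimes> t" using f t by simp
    also have "\<dots> = e \<otimes> t \<oplus> f \<otimes> t" using e(1) f(1) t(1) by (simp add: l_distr)
    finally have ft: "f \<otimes> t = t" using et f(1) t(1) by simp
    let ?u = "lam \<ominus> ?s"
    have u: "inv ?u \<in> carrier R" "inv ?u \<otimes> ?u = \<one>" "?u \<in> carrier R"
      using lam by auto
    have "\<zero> = f \<otimes> (z \<otimes> t)" using t f by simp
    also have "\<dots> = (f \<otimes> z) \<otimes> t" using f z t(1) by (simp add: m_assoc)
    also have "\<dots> = f \<otimes> (?u \<oplus> x \<otimes> ?s) \<otimes> t" by (simp only: fz)
    also have "\<dots> = (?u \<oplus> x \<otimes> ?s) \<otimes> (f \<otimes> t)"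
      using f(1) t(1) x u(3) lam(1) by (metis a_closed m_assoc m_closed m_comm sigma_simps(1))
    finally have 0: "(?u \<oplus> x \<otimes> ?s) \<otimes> t = \<zero>" using ft by simp
    define r where "r = \<ominus> (inv ?u \<otimes> ?s)"
    have r: "r \<in> carrier R" using u lam by (simp add: r_def)
    have "t = inv ?u \<otimes> ?u \<otimes> t" using u t by simp
    also have "\<dots> = x \<otimes> r \<otimes> t \<oplus> inv ?u \<otimes> ((?u \<oplus> x \<otimes> ?s) \<otimes> t)"
      unfolding r_def using u(1,3) x t(1) sigma_simps(1)[OF lam(1)] by algebra
    also have "\<dots> = x \<otimes> r \<otimes> t" using 0 u x r t by simp
    finally have step: "t = x \<otimes> r \<otimes> t" .
    \<comment> \<open>so \<open>t\<close> is divisible by \<open>e = x [^] M\<close>, but \<open>e\<close> annihilates \<open>t\<close>\<close>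
    have "t = (x \<otimes> r) [^] k \<otimes> t" for k :: nat
    proof (induction k)
      case (Suc k)
      have "(x \<otimes> r) [^] Suc k \<otimes> t = (x \<otimes> r) [^] k \<otimes> (x \<otimes> r \<otimes> t)"
        using x r t by (simp add: m_assoc)
      with Suc step show ?case by simp
    qed (use t in simp)
    from this[of M] have "t = r [^] M \<otimes> (e \<otimes> t)"
      using x r t(1) by (simp add: nat_pow_distrib e_def m_assoc m_lcomm)
    then show "t = \<zero>" using et r by simp
  qed
  with yz show thesis using that by blast
qed

text \<open>Let $U$ be the group of units, $N(y) = \sigma(y) y$ and $Q(z) = z/\sigma(z)$. The kernel of $Q$ is the
  group $F$ of fixed units, and by Hilbert 90 the kernel of $N$ is the image of $Q$. Hence
  $|N(U)| = |U|/|Q(U)| = |F|$, and since $N(U) \subseteq F$, the two groups coincide.\<close>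

lemma norm_surjective:
  assumes c: "c \<in> Units R" "\<sigma> c = c"
  obtains y where "y \<in> Units R" "\<sigma> y \<otimes> y = c"
proof -
  let ?G = "units_of R"
  interpret G: comm_group ?G by (rule units_comm_group)
  have fin: "finite (carrier ?G)"
    unfolding units_of_carrier using finite_carrier by (rule rev_finite_subset) auto
  have Uc: "x \<in> carrier R" if "x \<in> Units R" for x using that by auto
  define N where "N = (\<lambda>y. \<sigma> y \<otimes> y)"
  define Q where "Q = (\<lambda>z. z \<otimes> inv (\<sigma> z))"
  have "N \<in> hom ?G ?G"
    by (rule homI) (auto simp: N_def units_of_carrier units_of_mult sigma_Units Uc m_ac)
  then interpret N: group_hom ?G ?G N by unfold_locales
  have "Q \<in> hom ?G ?G"
  proof (rule homI; unfold units_of_carrier units_of_mult)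
    fix x y assume xy: "x \<in> Units R" "y \<in> Units R"
    have "inv (\<sigma> x \<otimes> \<sigma> y) = inv (\<sigma> x) \<otimes> inv (\<sigma> y)"
      using xy by (intro comm_inv_char) (auto simp: sigma_Units Uc m_ac)
    then show "Q (x \<otimes> y) = Q x \<otimes> Q y"
      using xy by (simp add: Q_def sigma_Units Uc m_ac)
  qed (auto simp: Q_def sigma_Units)
  then interpret Q: group_hom ?G ?G Q by unfold_locales
  have kerQ: "kernel ?G ?G Q = {z \<in> Units R. \<sigma> z = z}"
  proof -
    have "z \<otimes> inv (\<sigma> z) = \<one> \<longleftrightarrow> \<sigma> z = z" if "z \<in> Units R" for z
    proof -
      have "z \<otimes> inv (\<sigma> z) \<otimes> \<sigma> z = z" 
        using that sigma_Units[OF that] by (simp add: m_assoc Uc)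
      then show ?thesis using that sigma_Units[OF that] by (metis Units_closed Units_r_inv l_one)
    qed
    then show ?thesis by (auto simp: kernel_def Q_def units_of_carrier units_of_one)
  qed
  have kerN: "kernel ?G ?G N = Q ` carrier ?G"
  proof (intro equalityI subsetI)
    fix y assume "y \<in> kernel ?G ?G N"
    then have y: "y \<in> Units R" "y \<otimes> \<sigma> y = \<one>"
      by (auto simp: kernel_def N_def units_of_carrier units_of_one m_comm Uc)
    then obtain z where z: "z \<in> Units R" "z = y \<otimes> \<sigma> z"
      using hilbert_90 Uc by metis
    have "Q z = y \<otimes> (\<sigma> z \<otimes> inv (\<sigma> z))"
    proof -
      have "Q z = (y \<otimes> \<sigma> z) \<otimes> inv (\<sigma> z)"
        unfolding Q_def by (rule arg_cong[where f = "\<lambda>v. v \<otimes> inv (\<sigma> z)"]) (rule z(2))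
      then show ?thesis using y(1) sigma_Units[OF z(1)] by (simp add: m_assoc Uc)
    qed
    then have "Q z = y" using y sigma_Units[OF z(1)] by (simp add: Uc)
    then show "y \<in> Q ` carrier ?G" using z by (auto simp: units_of_carrier)
  next
    fix y assume "y \<in> Q ` carrier ?G"
    then obtain z where z: "z \<in> Units R" "y = z \<otimes> inv (\<sigma> z)" by (auto simp: Q_def units_of_carrier)
    have sz: "\<sigma> z \<in> Units R" using z sigma_Units by blast
    have "\<sigma> (inv (\<sigma> z)) = inv z"
    proof -
      have "\<sigma> (inv (\<sigma> z)) \<otimes> z = \<sigma> (inv (\<sigma> z) \<otimes> \<sigma> z)"
        using z sz by (simp add: involutive Uc del: Units_l_inv)
      then have "\<sigma> (inv (\<sigma> z)) \<otimes> z = \<one>" using sz by simp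
      then show ?thesis using z sz by (metis Units_closed Units_inv_closed comm_inv_char m_comm sigma_simps(1))
    qed
    then have "N y = (\<sigma> z \<otimes> inv z) \<otimes> (z \<otimes> inv (\<sigma> z))"
      using z sz by (simp add: N_def Uc)
    also have "\<dots> = (inv z \<otimes> z) \<otimes> (\<sigma> z \<otimes> inv (\<sigma> z))"
      using z(1) sz by (simp add: m_ac Uc del: Units_l_inv Units_r_inv)
    finally have "N y = \<one>" using z(1) sz by simp
    then show "y \<in> kernel ?G ?G N"
      using z sz by (auto simp: kernel_def units_of_carrier units_of_one)
  qed
  have "card (kernel ?G ?G N) * card (N ` carrier ?G) = card (kernel ?G ?G Q) * card (Q ` carrier ?G)"
    using N.card_kernel_image[OF fin] Q.card_kernel_image[OF fin] by simp
  moreover have "card (kernel ?G ?G N) > 0"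
    using fin by (auto simp: card_gt_0_iff kernel_def intro: G.one_closed)
  ultimately have "card (N ` carrier ?G) = card {z \<in> Units R. \<sigma> z = z}"
    using kerN kerQ by (simp add: mult.commute)
  moreover have "N ` carrier ?G \<subseteq> {z \<in> Units R. \<sigma> z = z}"
    by (auto simp: N_def units_of_carrier sigma_Units involutive Uc m_comm)
  moreover have "finite {z \<in> Units R. \<sigma> z = z}"
    using fin by (simp add: units_of_carrier)
  ultimately have "N ` carrier ?G = {z \<in> Units R. \<sigma> z = z}"
    by (simp add: card_subset_eq)
  with c obtain y where "y \<in> Units R" "N y = c"
    unfolding units_of_carrier by (metis (mono_tags, lifting) imageE mem_Collect_eq)
  then show thesis using that by (simp add: N_def)
qed

end

section \<open>Hermitian matrices over a finite field with a quadratic subfield\<close>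

definition adjoint :: "nat \<Rightarrow> 'a :: finite_field mat \<Rightarrow> 'a mat" where
  "adjoint q A = transpose_mat (bar_mat q A)"

lemma adjoint_carrier [simp]: "A \<in> carrier_mat m n \<Longrightarrow> adjoint q A \<in> carrier_mat n m"
  by (simp add: adjoint_def)

lemma finite_carrier_mat: "finite (carrier_mat m n :: 'a :: finite mat set)"
proof (rule finite_subset)
  show "carrier_mat m n \<subseteq> mat m n ` (({..<m} \<times> {..<n}) \<rightarrow>\<^sub>E (UNIV :: 'a set))"
  proof
    fix A :: "'a mat" assume A: "A \<in> carrier_mat m n"
    let ?f = "restrict (\<lambda>ij. A $$ ij) ({..<m} \<times> {..<n})"
    have "A = mat m n ?f" using A by (intro eq_matI) auto
    moreover have "?f \<in> ({..<m} \<times> {..<n}) \<rightarrow>\<^sub>E (UNIV :: 'a set)" by (simp add: PiE_def)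
    ultimately show "A \<in> mat m n ` (({..<m} \<times> {..<n}) \<rightarrow>\<^sub>E (UNIV :: 'a set))" by blast
  qed
qed (intro finite_imageI finite_PiE, auto)

lemma mult_cancel_middle:
  fixes A :: "'a :: semiring_1 mat"
  assumes "A \<in> carrier_mat n n" "B \<in> carrier_mat n n" "C \<in> carrier_mat n n" "D \<in> carrier_mat n n"
    and "B * C = 1\<^sub>m n"
  shows "(A * B) * (C * D) = A * D"
proof -
  have "(A * B) * (C * D) = A * ((B * C) * D)"
    using assms(1-4) by (simp add: assoc_mult_mat[of _ n n _ n _ n])
  then show ?thesis using assms by simp
qed

locale quadratic_finite_field =
  fixes q :: nat and ty :: "'a :: finite_field itself"
  assumes primepow_q: "primepow q" and card_field: "card (UNIV :: 'a set) = q\<^sup>2"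
begin

lemma q_pos: "q > 0" and q_gt_1: "q > 1"
  using primepow_q by (auto simp: primepow_gt_0_nat primepow_gt_Suc_0)

lemma bar_bar: "((a :: 'a) ^ q) ^ q = a"
  using finite_field_power_card_eq_same[of a] card_field
  by (simp add: power2_eq_square power_mult)

lemma bar_sum: "(\<Sum>i \<in> S. f i) ^ q = (\<Sum>i \<in> S. (f i :: 'a) ^ q)"
  by (induction S rule: infinite_finite_induct)
    (use q_pos in \<open>auto simp: bar_add[OF primepow_q card_field] power_0_left\<close>)

lemma adjoint_mult:
  fixes A B :: "'a mat"
  assumes "A \<in> carrier_mat m n" "B \<in> carrier_mat n k"
  shows "adjoint q (A * B) = adjoint q B * adjoint q A"
  using assms
  by (intro eq_matI)
    (auto simp: adjoint_def bar_mat_def scalar_prod_def bar_sum power_mult_distrib mult.commute)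

lemma adjoint_add:
  fixes A B :: "'a mat"
  assumes "A \<in> carrier_mat m n" "B \<in> carrier_mat m n"
  shows "adjoint q (A + B) = adjoint q A + adjoint q B"
  using assms by (intro eq_matI) (auto simp: adjoint_def bar_mat_def bar_add[OF primepow_q card_field])

lemma adjoint_adjoint [simp]: "adjoint q (adjoint q (A :: 'a mat)) = A"
  by (intro eq_matI) (auto simp: adjoint_def bar_mat_def bar_bar)

lemma adjoint_one [simp]: "adjoint q (1\<^sub>m n) = (1\<^sub>m n :: 'a mat)"
  using q_pos by (intro eq_matI) (auto simp: adjoint_def bar_mat_def)

lemma adjoint_scalar: "adjoint q (a \<cdot>\<^sub>m 1\<^sub>m n) = (a :: 'a) ^ q \<cdot>\<^sub>m 1\<^sub>m n"
  using q_pos by (intro eq_matI) (auto simp: adjoint_def bar_mat_def)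

lemma ex_not_bar_fixed: "\<exists>a :: 'a. a ^ q \<noteq> a"
proof (rule ccontr)
  assume "\<not> ?thesis"
  then have fixed: "a ^ q = a" for a :: 'a by auto
  \<comment> \<open>an identity \<open>a ^ q = a\<close> would give this polynomial of degree \<open>q\<close> as many as \<open>q\<^sup>2\<close> roots\<close>
  define p :: "'a poly" where "p = monom 1 q - monom 1 1"
  have "coeff p q = 1" using q_gt_1 by (simp add: p_def)
  then have "p \<noteq> 0" by auto
  then have "card {x. poly p x = 0} \<le> degree p"
    by (rule card_poly_roots_bound)
  also have "degree p \<le> q"
    unfolding p_def by (rule degree_diff_le) (use q_gt_1 in \<open>auto simp: degree_monom_eq\<close>)
  finally have "q\<^sup>2 \<le> q"
    using fixed by (simp add: p_def poly_monom card_field)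
  then show False using q_gt_1 by (simp add: power2_eq_square)
qed

text \<open>The bicommutant is used in place of the polynomials in \<open>H\<close>: it is visibly closed under all ring
  operations, inverses and (for self-adjoint \<open>H\<close>) adjoints, and it is commutative since it lies
  in the centralizer of \<open>H\<close>.\<close>

definition bicommutant :: "nat \<Rightarrow> 'a mat \<Rightarrow> 'a mat set" where
  "bicommutant n H = {b \<in> carrier_mat n n. \<forall>a \<in> carrier_mat n n. a * H = H * a \<longrightarrow> a * b = b * a}"

text \<open>Surjectivity of the norm map in the bicommutant of \<open>H\<close>. A non-degenerate Hermitian form
  is thereby equivalent to the standard one, by a change of basis that respects all symmetries of \<open>H\<close>.\<close>

lemma hermitian_eq_adjoint_mult:
  fixes H :: "'a mat"
  assumes H: "H \<in> carrier_mat n n" "adjoint q H = H"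
    and K: "K \<in> carrier_mat n n" "H * K = 1\<^sub>m n"
  obtains y z where "y \<in> carrier_mat n n" "z \<in> carrier_mat n n" "y * z = 1\<^sub>m n" "z * y = 1\<^sub>m n"
    "adjoint q y * y = H"
    "\<And>a. a \<in> carrier_mat n n \<Longrightarrow> a * H = H * a \<Longrightarrow> a * y = y * a"
proof -
  let ?C = "carrier_mat n n :: 'a mat set"
  let ?M = "ring_mat TYPE('a) n ()"
  note assoc = assoc_mult_mat[of _ n n _ n _ n] mult_carrier_mat[of _ n n _ n]
  have KH: "K * H = 1\<^sub>m n" using mat_mult_left_right_inverse[OF H(1) K] .
  define B where "B = bicommutant n H"
  have B: "b \<in> B \<longleftrightarrow> b \<in> ?C \<and> (\<forall>a \<in> ?C. a * H = H * a \<longrightarrow> a * b = b * a)" for b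
    by (auto simp: B_def bicommutant_def)
  have BC: "b \<in> ?C" if "b \<in> B" for b using that by (simp add: B)
  have comm: "b * c = c * b" if "b \<in> B" "c \<in> B" for b c
    using that H(1) unfolding B by metis
  have add: "b + c \<in> B" if "b \<in> B" "c \<in> B" for b c
    using that by (auto simp: B mult_add_distrib_mat[of _ n n _ n] add_mult_distrib_mat[of _ n n _ _ n])
  have mult: "b * c \<in> B" if "b \<in> B" "c \<in> B" for b c
  proof -
    have bc: "b \<in> ?C" "c \<in> ?C" using that BC by auto
    have "a * (b * c) = (b * c) * a" if a: "a \<in> ?C" "a * H = H * a" for a
    proof -
      have ab: "a * b = b * a" and ac: "a * c = c * a"
        using a \<open>b \<in> B\<close> \<open>c \<in> B\<close> by (auto simp: B)
      have "a * (b * c) = a * b * c" using a(1) bc by (simp add: assoc)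
      also have "\<dots> = b * a * c" by (simp only: ab)
      also have "\<dots> = b * (a * c)" using a(1) bc by (simp add: assoc)
      also have "\<dots> = b * (c * a)" by (simp only: ac)
      also have "\<dots> = (b * c) * a" using a(1) bc by (simp add: assoc)
      finally show ?thesis .
    qed
    then show ?thesis using bc by (auto simp: B)
  qed
  have uminus: "- b \<in> B" if "b \<in> B" for b
    using that by (auto simp: B)
  have scalar: "a \<cdot>\<^sub>m 1\<^sub>m n \<in> B" for a
    by (auto simp: B mult_smult_distrib[of _ n n _ n] mult_smult_assoc_mat[of _ n n _ n])
  have one: "1\<^sub>m n \<in> B" by (auto simp: B)
  have HB: "H \<in> B" using H by (auto simp: B)
  have inverse: "c \<in> B" if bc: "b \<in> B" "c \<in> ?C" "b * c = 1\<^sub>m n" "c * b = 1\<^sub>m n" for b c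
  proof -
    have b: "b \<in> ?C" using bc BC by auto
    have "a * c = c * a" if a: "a \<in> ?C" "a * H = H * a" for a
    proof -
      have ab: "a * b = b * a" using a bc by (auto simp: B)
      have "a * c = (c * b) * (a * c)" using a bc by simp
      also have "\<dots> = c * (b * a) * c" using a(1) b bc(2) by (simp add: assoc)
      also have "\<dots> = c * (a * b) * c" by (simp only: ab)
      also have "\<dots> = (c * a) * (b * c)" using a(1) b bc(2) by (simp add: assoc)
      finally show ?thesis using a bc by simp
    qed
    then show ?thesis using bc by (auto simp: B)
  qed
  have adj: "adjoint q b \<in> B" if b: "b \<in> B" for b
  proof -
    have "a * adjoint q b = adjoint q b * a" if a: "a \<in> ?C" "a * H = H * a" for a
    proof -
      have "adjoint q (a * H) = adjoint q (H * a)" using a by simp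
      then have "H * adjoint q a = adjoint q a * H"
        using a(1) H by (simp add: adjoint_mult[of _ n n _ n])
      then have "adjoint q a * b = b * adjoint q a"
        using b a by (auto simp: B)
      then have "adjoint q (adjoint q a * b) = adjoint q (b * adjoint q a)" by simp
      then show ?thesis using a BC[OF b] by (simp add: adjoint_mult[of _ n n _ n])
    qed
    then show ?thesis using BC[OF b] by (auto simp: B)
  qed
  define R where "R = ?M\<lparr>carrier := B\<rparr>"
  have ops: "carrier R = B" "mult R = (*)" "add R = (+)" "one R = 1\<^sub>m n" "zero R = 0\<^sub>m n n"
    by (simp_all add: R_def ring_mat_def)
  have zero: "0\<^sub>m n n \<in> B" by (auto simp: B)
  have "cring R"
  proof (rule cringI)
    show "abelian_group R"
    proof (rule abelian_groupI; unfold ops)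
      fix b assume "b \<in> B"
      then show "\<exists>c\<in>B. c + b = 0\<^sub>m n n"
        using uminus BC by (intro bexI[of _ "- b"]) (auto intro: uminus_l_inv_mat)
    qed (auto simp: add zero dest!: BC intro: comm_add_mat assoc_add_mat)
    show "Group.comm_monoid R"
    proof (rule comm_monoidI; unfold ops)
      fix b c d assume "b \<in> B" "c \<in> B" "d \<in> B"
      then show "b * c * d = b * (c * d)" by (auto dest!: BC intro: assoc_mult_mat)
    qed (auto simp: mult one comm dest: BC)
  qed (auto simp: ops dest!: BC intro: add_mult_distrib_mat)
  then interpret R: cring R .
  have a_inv: "\<ominus>\<^bsub>R\<^esub> b = - b" if "b \<in> B" for b
    using that uminus BC by (intro R.minus_equality) (auto simp: ops intro: uminus_l_inv_mat)
  obtain a :: 'a where a: "a ^ q \<noteq> a" using ex_not_bar_fixed by auto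
  have UnitsI: "b \<in> Units R" if "b \<in> B" "c \<in> ?C" "b * c = 1\<^sub>m n" "c * b = 1\<^sub>m n" for b c
    using that inverse[OF that] by (auto simp: Units_def ops)
  interpret R: finite_involutive_cring R "adjoint q" "a \<cdot>\<^sub>m 1\<^sub>m n"
  proof unfold_locales
    show "finite (carrier R)"
      unfolding ops using finite_carrier_mat BC by (meson finite_subset subsetI)
    show "adjoint q \<in> Ring.ring_hom R R"
      by (auto simp: Ring.ring_hom_def ops adj adjoint_add[of _ n n] adjoint_mult[of _ n n _ n] BC comm)
    let ?u = "a - a ^ q"
    have "a \<cdot>\<^sub>m 1\<^sub>m n \<ominus>\<^bsub>R\<^esub> adjoint q (a \<cdot>\<^sub>m 1\<^sub>m n) = ?u \<cdot>\<^sub>m 1\<^sub>m n"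
      using scalar by (auto simp: R.minus_eq ops adjoint_scalar a_inv intro!: eq_matI)
    also have "\<dots> \<in> Units R"
      by (rule UnitsI[OF scalar, of "inverse ?u \<cdot>\<^sub>m 1\<^sub>m n"])
        (use a in \<open>auto simp: mult_smult_distrib[of _ n n _ n] mult_smult_assoc_mat[of _ n n _ n] intro!: eq_matI\<close>)
    finally show "a \<cdot>\<^sub>m 1\<^sub>m n \<ominus>\<^bsub>R\<^esub> adjoint q (a \<cdot>\<^sub>m 1\<^sub>m n) \<in> Units R" .
  qed (auto simp: ops scalar)
  have "H \<in> Units R" using UnitsI[OF HB K(1) K(2) KH] .
  then obtain y where y: "y \<in> Units R" "adjoint q y * y = H"
    using R.norm_surjective[of H] H(2) unfolding ops by metis
  from y(1) obtain z where "y \<in> B" "z \<in> B" "y * z = 1\<^sub>m n" "z * y = 1\<^sub>m n"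
    by (auto simp: Units_def ops)
  with y(2) show thesis by (intro that[of y z]) (auto simp: B)
qed

section \<open>Conjugacy in the unitary group\<close>

lemma mem_unitary_group:
  "g \<in> carrier (unitary_group q n) \<longleftrightarrow> (g :: 'a mat) \<in> carrier_mat n n \<and> adjoint q g * g = 1\<^sub>m n"
  using invertible_matI[of g n "adjoint q g"]
  by (auto simp: unitary_group_def adjoint_def)

lemma unitary_group_ops:
  "x \<otimes>\<^bsub>unitary_group q n\<^esub> y = x * y" "\<one>\<^bsub>unitary_group q n\<^esub> = 1\<^sub>m n"
  by (auto simp: unitary_group_def)

lemma group_unitary: "group (unitary_group q n :: 'a mat monoid)"
  using group_unitary_group primepow_q card_field .

lemma inv_unitary:
  assumes g: "(g :: 'a mat) \<in> carrier (unitary_group q n)"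
  shows "inv\<^bsub>unitary_group q n\<^esub> g = adjoint q g"
proof -
  interpret group "unitary_group q n :: 'a mat monoid" by (rule group_unitary)
  have g': "g \<in> carrier_mat n n" "adjoint q g * g = 1\<^sub>m n" using g by (auto simp: mem_unitary_group)
  have "g * adjoint q g = 1\<^sub>m n"
    using mat_mult_left_right_inverse[of "adjoint q g" n g] g' by simp
  then have "adjoint q g \<in> carrier (unitary_group q n)" using g' by (simp add: mem_unitary_group)
  then show ?thesis using g g' by (intro inv_equality) (auto simp: unitary_group_ops)
qed

text \<open>If \<open>x\<close> conjugates \<open>g\<close> to \<open>h\<close> and both are unitary, then \<open>c = adjoint q x * x\<close> commutes with \<open>g\<close>.
  Writing \<open>c = adjoint q y * y\<close> with \<open>y\<close> commuting with \<open>g\<close>, the quotient of \<open>x\<close> by \<open>y\<close> is unitary and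
  still conjugates \<open>g\<close> to \<open>h\<close>.\<close>

lemma unitary_similar_imp_conjugate:
  fixes g h :: "'a mat"
  assumes g: "g \<in> carrier (unitary_group q n)" and h: "h \<in> carrier (unitary_group q n)"
    and "similar_mat h g"
  obtains u where "u \<in> carrier (unitary_group q n)" "h = u * g * adjoint q u"
proof -
  let ?C = "carrier_mat n n :: 'a mat set"
  note assoc = assoc_mult_mat[of _ n n _ n _ n] mult_carrier_mat[of _ n n _ n]
  have gC: "g \<in> ?C" "adjoint q g * g = 1\<^sub>m n" and hC: "h \<in> ?C" "adjoint q h * h = 1\<^sub>m n"
    using g h by (auto simp: mem_unitary_group)
  obtain x x' where wit: "similar_mat_wit h g x x'"
    using assms(3) by (auto simp: similar_mat_def)
  have w: "x \<in> ?C" "x' \<in> ?C" "x * x' = 1\<^sub>m n" "x' * x = 1\<^sub>m n" and h_eq: "h = x * g * x'"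
    using similar_mat_witD2[OF hC(1) wit] by auto
  have hx: "h * x = x * g" unfolding h_eq using w gC by (simp add: assoc)
  define c where "c = adjoint q x * x"
  have c: "c \<in> ?C" "adjoint q c = c" 
    using w by (auto simp: c_def adjoint_mult[of _ n n _ n] mult_carrier_mat[of _ n n])
  have adjx: "adjoint q x * adjoint q x' = 1\<^sub>m n"
    using adjoint_mult[OF w(2,1)] w(4) by simp
  have cinv: "c * (x' * adjoint q x') = 1\<^sub>m n"
    unfolding c_def using mult_cancel_middle[of "adjoint q x" n x x' "adjoint q x'"] w adjx by simp
  have gcg: "adjoint q g * c * g = c"
  proof -
    have "adjoint q g * c * g = adjoint q (x * g) * (x * g)"
      using w(1) gC(1) by (simp add: c_def adjoint_mult[of _ n n _ n] assoc)
    also have "\<dots> = adjoint q (h * x) * (h * x)" by (simp add: hx)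
    also have "\<dots> = adjoint q x * x"
      using mult_cancel_middle[of "adjoint q x" n "adjoint q h" h x] w(1) hC
      by (simp add: adjoint_mult[of _ n n _ n])
    finally show ?thesis by (simp add: c_def)
  qed
  have gg: "g * adjoint q g = 1\<^sub>m n"
    using mat_mult_left_right_inverse[of "adjoint q g" n g] gC by simp
  have "g * (adjoint q g * c * g) = (g * adjoint q g) * (c * g)"
    using gC(1) c(1) by (simp add: assoc)
  then have gc: "g * c = c * g" using gg gC(1) c(1) gcg by simp
  obtain y z where y: "y \<in> ?C" "z \<in> ?C" "y * z = 1\<^sub>m n" "z * y = 1\<^sub>m n" "adjoint q y * y = c"
    and comm: "\<And>a. a \<in> ?C \<Longrightarrow> a * c = c * a \<Longrightarrow> a * y = y * a"
  proof (rule hermitian_eq_adjoint_mult[OF c _ cinv])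
    show "x' * adjoint q x' \<in> ?C" using w(2) mult_carrier_mat[of x' n n] by simp
  qed (rule that)
  have gy: "g * y = y * g" using comm gC gc by simp
  define u where "u = x * z"
  have u: "u \<in> ?C" using w y by (simp add: u_def)
  have "adjoint q u * u = adjoint q z * (adjoint q x * x) * z"
    using w(1) y(2) by (simp add: u_def adjoint_mult[of _ n n _ n] assoc)
  also have "\<dots> = adjoint q z * (adjoint q y * y) * z"
    by (simp add: y(5) c_def)
  also have "\<dots> = adjoint q (y * z) * (y * z)"
    using y(1,2) by (simp add: adjoint_mult[of _ n n _ n] assoc)
  finally have uu: "adjoint q u * u = 1\<^sub>m n" using y(3) by simp
  have uU: "u \<in> carrier (unitary_group q n)" using u uu by (simp add: mem_unitary_group)
  have uu': "u * adjoint q u = 1\<^sub>m n"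
    using mat_mult_left_right_inverse[of "adjoint q u" n u] u uu by simp
  have gz: "g * z = z * g"
  proof -
    have "g * z = (z * y) * (g * z)" using y(1,2,4) gC(1) by simp
    also have "\<dots> = z * (y * g) * z" using y(1,2) gC(1) by (simp add: assoc)
    also have "\<dots> = z * (g * y) * z" by (simp add: gy)
    also have "\<dots> = z * g * (y * z)" using y(1,2) gC(1) by (simp add: assoc)
    finally show ?thesis using y(2,3) gC(1) by simp
  qed
  have "h * u = (h * x) * z" unfolding u_def using w(1) y(2) hC(1) by (simp add: assoc)
  also have "\<dots> = x * (g * z)" using w(1) y(2) gC(1) by (simp add: hx assoc)
  also have "\<dots> = u * g" unfolding u_def gz using w(1) y(2) gC(1) by (simp add: assoc)
  finally have hu: "h * u = u * g" .
  have "h = (h * u) * adjoint q u" using uu' u hC(1) by (simp add: assoc)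
  then have "h = u * g * adjoint q u" by (simp add: hu)
  then show thesis using that uU by blast
qed

end

section \<open>Intertwiners and the socle of a nilpotent matrix\<close>

text \<open>For a projection \<open>E\<close> these identities say that its image is $\ker N \cap \mathrm{im}\, N^r$. The last
  one certifies that the image is large enough: multiplying it by a vector \<open>w\<close> with $N^{r+1} w = 0$ gives
  $N^r w = E N^r w$.\<close>

definition socle_projection :: "nat \<Rightarrow> nat \<Rightarrow> 'a :: comm_ring_1 mat \<Rightarrow> 'a mat \<Rightarrow> bool" where
  "socle_projection n r N E \<longleftrightarrow>
     N \<in> carrier_mat n n \<and> E \<in> carrier_mat n n \<and> N * E = 0\<^sub>m n n \<and>
     (\<exists>F \<in> carrier_mat n n. E = N ^\<^sub>m r * F) \<and>
     (\<exists>G \<in> carrier_mat n n. N ^\<^sub>m r = E * N ^\<^sub>m r + G * N ^\<^sub>m Suc r)"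

lemma mult_add_one_left:
  fixes N :: "'a :: comm_ring_1 mat"
  assumes "N \<in> carrier_mat n n" "X \<in> carrier_mat n k"
  shows "(1\<^sub>m n + N) * X = X + N * X"
  using assms by (subst add_mult_distrib_mat[of _ n n]) auto

lemma mult_add_one_right:
  fixes N :: "'a :: comm_ring_1 mat"
  assumes "N \<in> carrier_mat n n" "X \<in> carrier_mat k n"
  shows "X * (1\<^sub>m n + N) = X + X * N"
  using assms by (subst mult_add_distrib_mat[of _ k n _ n]) auto

text \<open>The hypothesis \<open>J1 * X * J0 = X\<close>, where \<open>J0\<close> and \<open>J1\<close> stand for the unipotent matrices, covers both an element
  that inverts \<open>J0\<close> (with \<open>J1 = J0\<close>) and a bilinear form invariant under \<open>J0\<close> (with \<open>J1\<close>
  the transpose of \<open>J0\<close>). Expanding it gives \<open>T * N0 = N1 * (- T * J0)\<close> for \<open>T = X\<close>, and \<open>- T * J0\<close>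
  satisfies the same hypothesis, so that the step can be repeated.\<close>

lemma intertwiner_power:
  fixes X :: "'a :: comm_ring_1 mat"
  assumes C: "N0 \<in> carrier_mat n n" "N1 \<in> carrier_mat n n" "X \<in> carrier_mat n n"
    and X: "(1\<^sub>m n + N1) * X * (1\<^sub>m n + N0) = X"
  shows "\<exists>T \<in> carrier_mat n n. (1\<^sub>m n + N1) * T * (1\<^sub>m n + N0) = T \<and> X * N0 ^\<^sub>m k = N1 ^\<^sub>m k * T"
proof (induction k)
  case 0
  then show ?case using C X by (intro bexI[of _ X]) auto
next
  note assoc = assoc_mult_mat[of _ n n _ n _ n] mult_carrier_mat[of _ n n _ n]
  case (Suc k)
  let ?C = "carrier_mat n n :: 'a mat set"
  let ?J0 = "1\<^sub>m n + N0" and ?J1 = "1\<^sub>m n + N1"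
  have J: "?J0 \<in> ?C" "?J1 \<in> ?C" using C by auto
  from Suc obtain T where T: "T \<in> ?C" "?J1 * T * ?J0 = T" "X * N0 ^\<^sub>m k = N1 ^\<^sub>m k * T" by blast
  define Y where "Y = T * ?J0"
  have Y: "Y \<in> ?C" using T J by (simp add: Y_def)
  have "Y + N1 * Y = T"
    using T J mult_add_one_left[OF C(2) Y] unfolding Y_def by (simp add: assoc)
  moreover have "Y = T + T * N0"
    unfolding Y_def by (rule mult_add_one_right) (use C T in auto)
  ultimately have sum: "T + T * N0 + N1 * Y = T" by simp
  have TN: "T * N0 = N1 * (- Y)"
  proof (rule eq_matI)
    fix i j assume ij: "i < dim_row (N1 * - Y)" "j < dim_col (N1 * - Y)"
    have "(T + T * N0 + N1 * Y) $$ (i, j) = T $$ (i, j)" by (simp only: sum)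
    moreover have "N1 * (- Y) = - (N1 * Y)" using C Y by simp
    ultimately show "(T * N0) $$ (i, j) = (N1 * - Y) $$ (i, j)"
      using ij T C Y by (simp add: algebra_simps eq_neg_iff_add_eq_0)
  qed (use C T Y in auto)
  have "X * N0 ^\<^sub>m Suc k = (X * N0 ^\<^sub>m k) * N0"
    using C by (simp add: assoc)
  also have "\<dots> = N1 ^\<^sub>m k * (T * N0)"
    unfolding T(3) using C T(1) by (simp add: assoc)
  also have "\<dots> = N1 ^\<^sub>m Suc k * (- Y)"
    unfolding TN using C Y by (simp add: assoc)
  finally have "X * N0 ^\<^sub>m Suc k = N1 ^\<^sub>m Suc k * (- Y)" .
  moreover have "?J1 * (- Y) * ?J0 = - Y"
  proof -
    have "?J1 * Y * ?J0 = (?J1 * T * ?J0) * ?J0" unfolding Y_def using J T(1) by (simp add: assoc)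
    then have "?J1 * Y * ?J0 = Y" by (simp add: T(2) Y_def)
    moreover have "?J1 * (- Y) * ?J0 = - (?J1 * Y * ?J0)"
      using carrier_matD[OF J(1)] carrier_matD[OF J(2)] carrier_matD[OF Y] by simp
    ultimately show ?thesis by simp
  qed
  ultimately show ?case using Y by (intro bexI[of _ "- Y"]) auto
qed

text \<open>The image of \<open>E0\<close> lies in the image of \<open>N0\<close> to the power \<open>r\<close>, which \<open>X\<close> maps into the image of the
  same power of \<open>N1\<close>; and it consists of fixed vectors of the first unipotent matrix, which \<open>X\<close>
  maps to fixed vectors of the second.\<close>

lemma intertwiner_preserves_socle:
  fixes X :: "'a :: comm_ring_1 mat"
  assumes s0: "socle_projection n r N0 E0" and s1: "socle_projection n r N1 E1"
    and X: "X \<in> carrier_mat n n" "(1\<^sub>m n + N1) * X * (1\<^sub>m n + N0) = X"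
  shows "X * E0 = E1 * (X * E0)"
proof -
  note assoc = assoc_mult_mat[of _ n n _ n _ n] mult_carrier_mat[of _ n n _ n]
  let ?C = "carrier_mat n n :: 'a mat set"
  have C: "N0 \<in> ?C" "N1 \<in> ?C" "E0 \<in> ?C" "E1 \<in> ?C" and NE: "N0 * E0 = 0\<^sub>m n n"
    using s0 s1 by (auto simp: socle_projection_def)
  obtain F where F: "F \<in> ?C" "E0 = N0 ^\<^sub>m r * F"
    using s0 unfolding socle_projection_def by blast
  obtain G where G: "G \<in> ?C" "N1 ^\<^sub>m r = E1 * N1 ^\<^sub>m r + G * N1 ^\<^sub>m Suc r"
    using s1 unfolding socle_projection_def by blast
  obtain T where T: "T \<in> ?C" "X * N0 ^\<^sub>m r = N1 ^\<^sub>m r * T"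
    using intertwiner_power[OF C(1,2) X] by blast
  have pow: "N1 ^\<^sub>m r \<in> ?C" "N0 ^\<^sub>m r \<in> ?C" using C by auto
  have XE: "X * E0 = N1 ^\<^sub>m r * (T * F)"
  proof -
    have "X * E0 = (X * N0 ^\<^sub>m r) * F" unfolding F(2) using X(1) pow F(1) by (simp add: assoc)
    then show ?thesis unfolding T(2) using pow T(1) F(1) by (simp add: assoc)
  qed
  have XEC: "X * E0 \<in> ?C" using X C by simp
  have kill: "N1 * (X * E0) = 0\<^sub>m n n"
  proof -
    have "(1\<^sub>m n + N0) * E0 = E0" using mult_add_one_left[OF C(1,3)] C NE by simp
    then have "X * E0 = (1\<^sub>m n + N1) * X * (1\<^sub>m n + N0) * E0" by (simp only: X(2))
    also have "\<dots> = (1\<^sub>m n + N1) * X * ((1\<^sub>m n + N0) * E0)" using X(1) C by (simp add: assoc)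
    also have "(1\<^sub>m n + N0) * E0 = E0" using mult_add_one_left[OF C(1,3)] C NE by simp
    also have "(1\<^sub>m n + N1) * X * E0 = (1\<^sub>m n + N1) * (X * E0)" using X(1) C by (simp add: assoc)
    also have "\<dots> = X * E0 + N1 * (X * E0)" using mult_add_one_left[OF C(2) XEC] .
    finally have sum: "X * E0 + N1 * (X * E0) = X * E0" by simp
    show ?thesis
    proof (rule eq_matI)
      fix i j assume ij: "i < dim_row (0\<^sub>m n n :: 'a mat)" "j < dim_col (0\<^sub>m n n :: 'a mat)"
      have "(X * E0 + N1 * (X * E0)) $$ (i, j) = (X * E0) $$ (i, j)" by (simp only: sum)
      moreover have "N1 * (X * E0) \<in> ?C" using C XEC by simp
      ultimately show "(N1 * (X * E0)) $$ (i, j) = (0\<^sub>m n n :: 'a mat) $$ (i, j)"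
        using ij XEC by (simp del: index_mult_mat add: index_add_mat)
    qed (use C X in auto)
  qed
  have TF: "T * F \<in> ?C" using T(1) F(1) by simp
  have "N1 * (N1 ^\<^sub>m r * (T * F)) = 0\<^sub>m n n" using kill by (simp only: XE)
  moreover have "N1 * N1 ^\<^sub>m r = N1 ^\<^sub>m Suc r"
  proof (induction r)
    case (Suc r)
    have "N1 * N1 ^\<^sub>m Suc r = (N1 * N1 ^\<^sub>m r) * N1" using C(2) by (simp add: assoc)
    then show ?case using Suc by simp
  qed (use C in simp)
  ultimately have k: "N1 ^\<^sub>m Suc r * (T * F) = 0\<^sub>m n n"
    using C pow TF by (metis assoc_mult_mat)
  have "X * E0 = (E1 * N1 ^\<^sub>m r + G * N1 ^\<^sub>m Suc r) * (T * F)"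
    unfolding XE by (subst G(2)) (rule refl)
  also have "\<dots> = (E1 * N1 ^\<^sub>m r) * (T * F) + (G * N1 ^\<^sub>m Suc r) * (T * F)"
    by (rule add_mult_distrib_mat[of _ n n _ _ n]) (use C pow G(1) TF in \<open>auto simp: assoc\<close>)
  also have "(G * N1 ^\<^sub>m Suc r) * (T * F) = G * (N1 ^\<^sub>m Suc r * (T * F))"
    by (rule assoc_mult_mat[of _ n n _ n _ n]) (use C pow G(1) TF in \<open>auto simp: assoc\<close>)
  also have "\<dots> = 0\<^sub>m n n" unfolding k using G(1) by simp
  also have "(E1 * N1 ^\<^sub>m r) * (T * F) = E1 * (X * E0)"
    unfolding XE using C pow TF by (simp add: assoc)
  finally show ?thesis using C XEC by simp
qed

section \<open>Compression to the middle layer\<close>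

text \<open>
  The flag $A \subseteq A^\perp \subseteq V$ with $A = \ker N \cap \mathrm{im}\, N^r$, in coordinates. In
  a Jordan basis of \<open>N\<close> each block of size greater than \<open>r\<close> contributes its first basis vector to
  layer 0 (projection \<open>E0\<close>), its last one to layer 2 (projection \<open>E2\<close>) and the rest to layer 1;
  smaller blocks lie in layer 1 entirely. The columns of \<open>P\<close> are the basis vectors of layer 1, so
  that $P^\top X P$ is the middle block of \<open>X\<close>. Layer 2 is described through the transpose of \<open>N\<close>
  because it is the image of layer 0 under an invariant form, and a form intertwines \<open>N\<close>
  with the transpose of \<open>N\<close>, up to units.
\<close>

locale core_compression =
  fixes n m r :: nat and N P E0 E2 N' :: "'a :: field mat"
  assumes P_carrier: "P \<in> carrier_mat n m"
    and socle_E0: "socle_projection n r N E0"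
    and socle_E2: "socle_projection n r (transpose_mat N) E2"
    and E0_symmetric: "transpose_mat E0 = E0"
    and E2_symmetric: "transpose_mat E2 = E2"
    and layers: "E0 + P * transpose_mat P + E2 = 1\<^sub>m n"
    and P_isometric: "transpose_mat P * P = 1\<^sub>m m"
    and Q_E0: "transpose_mat P * E0 = 0\<^sub>m m n"
    and Q_E2: "transpose_mat P * E2 = 0\<^sub>m m n"
    and compress_N: "transpose_mat P * N * P = N'"
begin

abbreviation "Q \<equiv> transpose_mat P"
abbreviation "J \<equiv> 1\<^sub>m n + N"
abbreviation "compress X \<equiv> Q * X * P"
abbreviation "C \<equiv> carrier_mat n n :: 'a mat set"

lemma carriers: "P \<in> carrier_mat n m" "Q \<in> carrier_mat m n" "N \<in> C" "E0 \<in> C" "E2 \<in> C" "J \<in> C"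
  using P_carrier socle_E0 socle_E2 unfolding socle_projection_def by auto

lemma N_E0: "N * E0 = 0\<^sub>m n n"
  using socle_E0 by (simp add: socle_projection_def)

lemmas layer_simps = E0_symmetric E2_symmetric P_isometric Q_E0 Q_E2 compress_N N_E0

lemmas assoc = assoc_mult_mat[of _ n n _ n _ n] assoc_mult_mat[of _ m n _ n _ n] 
  assoc_mult_mat[of _ n n _ n _ m] assoc_mult_mat[of _ m n _ n _ m] assoc_mult_mat[of _ n m _ n _ n]
  assoc_mult_mat[of _ n m _ n _ m] assoc_mult_mat[of _ m m _ n _ n] assoc_mult_mat[of _ m m _ n _ m]
  assoc_mult_mat[of _ n n _ m _ n] assoc_mult_mat[of _ n n _ m _ m] assoc_mult_mat[of _ m n _ m _ m] assoc_mult_mat[of _ m n _ m _ n]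
  assoc_mult_mat[of _ m m _ m _ m] assoc_mult_mat[of _ m m _ m _ n] assoc_mult_mat[of _ n m _ m _ m] assoc_mult_mat[of _ n m _ m _ n]
  mult_carrier_mat[of _ n n _ n] mult_carrier_mat[of _ m n _ n] mult_carrier_mat[of _ n n _ m] mult_carrier_mat[of _ m n _ m]
  mult_carrier_mat[of _ n m _ n] mult_carrier_mat[of _ m m _ n] mult_carrier_mat[of _ n m _ m] mult_carrier_mat[of _ m m _ m]

lemma compress_carrier: "X \<in> C \<Longrightarrow> compress X \<in> carrier_mat m m"
  using carriers by (simp add: assoc)

lemma transpose_J: "transpose_mat J = 1\<^sub>m n + transpose_mat N"
  using carriers(3) by (simp add: transpose_add[of _ n n])

lemma compress_J: "compress J = 1\<^sub>m m + N'"
proof -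
  have "Q * J = Q + Q * N" by (rule mult_add_one_right) (use carriers in auto)
  then have "compress J = Q * P + Q * N * P"
    using carriers by (simp add: add_mult_distrib_mat[of _ m n _ _ m] assoc)
  then show ?thesis by (simp add: layer_simps)
qed

lemma E2_P: "E2 * P = 0\<^sub>m n m"
  using transpose_mult[OF carriers(2,5)] by (simp add: layer_simps)

lemma J_E0: "J * E0 = E0"
  using mult_add_one_left[of N n E0 n] carriers layer_simps by simp

lemma transpose_triple:
  assumes "A \<in> C" "X \<in> C" "B \<in> C"
  shows "transpose_mat (A * X * B) = transpose_mat B * transpose_mat X * transpose_mat A"
  using assms by (simp add: transpose_mult[of _ n n _ n] assoc)

lemma E2_J: "E2 * J = E2"
proof -
  have "transpose_mat N * E2 = 0\<^sub>m n n" using socle_E2 by (simp add: socle_projection_def)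
  then have "transpose_mat (transpose_mat N * E2) = 0\<^sub>m n n" by simp
  then have "E2 * N = 0\<^sub>m n n" using carriers layer_simps by (simp add: transpose_mult[of _ n n _ n])
  then show ?thesis using mult_add_one_right[of N n E2 n] carriers by simp
qed

text \<open>The unit matrix between \<open>X\<close> and \<open>Y\<close> is the sum of the projections onto the three layers; the terms
  with the outer layers \<open>A\<close> and \<open>B\<close> vanish. Block triangular matrices need \<open>A = E0\<close>, and their
  transposes need \<open>A = E2\<close>.\<close>

lemma compress_mult:
  assumes XY: "X \<in> C" "Y \<in> C" and EE: "{A, B} = {E0, E2}"
    and A: "Q * (X * A) = 0\<^sub>m m n" and B: "B * (Y * P) = 0\<^sub>m n m"
  shows "compress (X * Y) = compress X * compress Y"
proof -
  have AB: "A \<in> C" "B \<in> C" using EE carriers by (auto simp: doubleton_eq_iff)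
  have sum: "A + P * Q + B = 1\<^sub>m n"
  proof -
    have "E2 + P * Q + E0 = E0 + P * Q + E2"
      using carriers by (intro eq_matI) (auto simp: add_ac)
    then show ?thesis using EE layers by (auto simp: doubleton_eq_iff)
  qed
  have QX: "Q * X \<in> carrier_mat m n" and YP: "Y * P \<in> carrier_mat n m" using XY carriers by (auto simp: assoc)
  have PQ: "P * Q \<in> C" using carriers by (simp add: assoc)
  have "compress (X * Y) = (Q * X) * ((A + P * Q + B) * (Y * P))"
    unfolding sum using XY carriers by (simp add: assoc)
  also have "(A + P * Q + B) * (Y * P) = (A + P * Q) * (Y * P) + B * (Y * P)"
    by (rule add_mult_distrib_mat[of _ n n _ _ m]) (use AB PQ YP in auto)
  also have "\<dots> = A * (Y * P) + P * Q * (Y * P)"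
    using AB PQ YP B by (simp add: add_mult_distrib_mat[of _ n n _ _ m] assoc)
  also have "Q * X * \<dots> = Q * X * (A * (Y * P)) + Q * X * (P * Q * (Y * P))"
    by (rule mult_add_distrib_mat[of _ m n _ m]) (use AB PQ QX YP in \<open>auto simp: assoc\<close>)
  also have "Q * X * (A * (Y * P)) = Q * (X * A) * (Y * P)"
    using AB YP XY carriers by (simp add: assoc)
  also have "\<dots> = 0\<^sub>m m m" unfolding A using left_mult_zero_mat[OF YP] .
  also have "Q * X * (P * Q * (Y * P)) = compress X * compress Y"
    using XY carriers by (simp add: assoc)
  finally show ?thesis using XY carriers by (simp add: assoc)
qed

lemma kill_left:
  assumes "X \<in> C" "A \<in> C" "B \<in> {E0, E2}" "X * A = B * (X * A)"
  shows "Q * (X * A) = 0\<^sub>m m n"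
proof -
  have B: "B \<in> C" "Q * B = 0\<^sub>m m n" using assms carriers layer_simps by auto
  have XA: "X * A \<in> C" using assms by simp
  have "Q * (X * A) = Q * (B * (X * A))" using assms(4) by (rule arg_cong)
  also have "\<dots> = Q * B * (X * A)"
    by (rule assoc_mult_mat[symmetric, of _ m n _ n _ n]) (use B XA carriers in auto)
  finally show ?thesis unfolding B(2) using left_mult_zero_mat[OF XA] by simp
qed

lemma kill_right:
  assumes X: "X \<in> C" "A \<in> C" and A: "transpose_mat A = A" "Q * (transpose_mat X * A) = 0\<^sub>m m n"
  shows "A * (X * P) = 0\<^sub>m n m"
proof -
  have "transpose_mat (A * (X * P)) = Q * (transpose_mat X * A)"
    using X A carriers by (simp add: transpose_mult[of _ n n _ m] transpose_mult[of _ n n _ n] assoc)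
  then have "transpose_mat (transpose_mat (A * (X * P))) = 0\<^sub>m n m" by (simp add: A)
  then show ?thesis by simp
qed

lemma transpose_closed: "X \<in> C \<Longrightarrow> transpose_mat X \<in> C"
  by simp

text \<open>A matrix that inverts \<open>J\<close> is block upper triangular. The first zero block comes from the socle of
  \<open>N\<close>, the second from the socle of the transpose of \<open>N\<close>.\<close>

lemma inverted_kill:
  assumes X: "X \<in> C" "J * X * J = X"
  shows "Q * (X * E0) = 0\<^sub>m m n" "E2 * (X * P) = 0\<^sub>m n m"
proof -
  show "Q * (X * E0) = 0\<^sub>m m n"
    using kill_left[OF X(1) carriers(4) _ intertwiner_preserves_socle[OF socle_E0 socle_E0 X]] by simp
  have "transpose_mat J * transpose_mat X * transpose_mat J = transpose_mat X"
    using transpose_triple[OF carriers(6) X(1) carriers(6)] by (simp only: X(2))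
  then have *: "transpose_mat X * E2 = E2 * (transpose_mat X * E2)"
    unfolding transpose_J
    by (rule intertwiner_preserves_socle[OF socle_E2 socle_E2 transpose_closed[OF X(1)]])
  show "E2 * (X * P) = 0\<^sub>m n m"
    by (rule kill_right[OF X(1) carriers(5) E2_symmetric kill_left[OF transpose_closed[OF X(1)] carriers(5) _ *]]) simp
qed

lemma dual_inverted_kill:
  assumes X: "X \<in> C" "transpose_mat J * X * transpose_mat J = X"
  shows "Q * (X * E2) = 0\<^sub>m m n"
  using kill_left[OF X(1) carriers(5) _
      intertwiner_preserves_socle[OF socle_E2 socle_E2 X[unfolded transpose_J]]] by simp

text \<open>An invariant form pairs layer 0 with layer 2 only: this is the orthogonality of $A$ and $A^\perp$.\<close>

lemma form_kill:
  assumes X: "X \<in> C" "transpose_mat J * X * J = X"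
  shows "Q * (X * E0) = 0\<^sub>m m n" "E0 * X = (E0 * X) * E2"
proof -
  show "Q * (X * E0) = 0\<^sub>m m n"
    using kill_left[OF X(1) carriers(4) _
        intertwiner_preserves_socle[OF socle_E0 socle_E2 X[unfolded transpose_J]]] by simp
  have "transpose_mat J * transpose_mat X * J = transpose_mat X"
    using transpose_triple[OF transpose_closed[OF carriers(6)] X(1) carriers(6)] by (simp add: X(2))
  then have "transpose_mat X * E0 = E2 * (transpose_mat X * E0)"
    unfolding transpose_J
    by (rule intertwiner_preserves_socle[OF socle_E0 socle_E2 transpose_closed[OF X(1)]])
  then have eq: "transpose_mat (transpose_mat X * E0) = transpose_mat (E2 * (transpose_mat X * E0))"
    by (rule arg_cong)
  have "transpose_mat (transpose_mat X * E0) = E0 * X"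
    using X(1) carriers(4) E0_symmetric by (simp add: transpose_mult[of _ n n _ n])
  moreover have "transpose_mat (E2 * (transpose_mat X * E0)) = (E0 * X) * E2"
    using X(1) carriers(4,5) E0_symmetric E2_symmetric by (simp add: transpose_mult[of _ n n _ n])
  ultimately show "E0 * X = (E0 * X) * E2" using eq by simp
qed

lemma dual_form_kill:
  assumes X: "X \<in> C" "J * X * transpose_mat J = X"
  shows "E2 * (X * P) = 0\<^sub>m n m"
proof -
  have "J * transpose_mat X * transpose_mat J = transpose_mat X"
    using transpose_triple[OF carriers(6) X(1) transpose_closed[OF carriers(6)]] by (simp add: X(2))
  then have *: "transpose_mat X * E2 = E0 * (transpose_mat X * E2)"
    unfolding transpose_J
    by (rule intertwiner_preserves_socle[OF socle_E2 socle_E0 transpose_closed[OF X(1)]])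
  show ?thesis
    by (rule kill_right[OF X(1) carriers(5) E2_symmetric kill_left[OF transpose_closed[OF X(1)] carriers(5) _ *]]) simp
qed

lemma compress_one: "compress (1\<^sub>m n) = 1\<^sub>m m"
  using carriers layer_simps by simp

lemma J_kill: "Q * (J * E0) = 0\<^sub>m m n" "E2 * (J * P) = 0\<^sub>m n m"
proof -
  show "Q * (J * E0) = 0\<^sub>m m n" by (simp add: J_E0 layer_simps)
  have "E2 * (J * P) = (E2 * J) * P" using carriers by (simp add: assoc)
  then show "E2 * (J * P) = 0\<^sub>m n m" by (simp only: E2_J E2_P)
qed

lemma compress_inverting:
  assumes S: "S \<in> C" "J * S * J = S"
  shows "compress J * compress S * compress J = compress S"
proof -
  have SJ: "S * J \<in> C" "J * (S * J) * J = S * J"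
    using S(1) carriers(6) S(2) by (simp_all add: assoc)
  have "compress S = compress (J * (S * J))"
    using S carriers(6) by (simp add: assoc)
  also have "\<dots> = compress J * compress (S * J)"
    by (rule compress_mult[OF carriers(6) SJ(1) refl J_kill(1) inverted_kill(2)[OF SJ]])
  also have "compress (S * J) = compress S * compress J"
    by (rule compress_mult[OF S(1) carriers(6) refl inverted_kill(1)[OF S] J_kill(2)])
  finally show ?thesis
    using compress_carrier[OF S(1)] compress_carrier[OF carriers(6)] by (simp add: assoc_mult_mat[of _ m m _ m _ m])
qed

lemma compress_involution:
  assumes S: "S \<in> C" "J * S * J = S" "S * S = 1\<^sub>m n"
  shows "compress S * compress S = 1\<^sub>m m"
  using compress_mult[OF S(1,1) refl inverted_kill[OF S(1,2)]] by (simp only: S(3) compress_one)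

text \<open>Non-degeneracy of the compressed form: the inverse \<open>K\<close> of the Gram matrix satisfies the dual invariance
  \<open>J * K * transpose_mat J = K\<close>, so the compression of \<open>K\<close> inverts that of \<open>H\<close>.\<close>

lemma compress_form_inverse:
  assumes H: "H \<in> C" "transpose_mat J * H * J = H" and K: "K \<in> C" "H * K = 1\<^sub>m n"
  shows "compress H * compress K = 1\<^sub>m m"
proof -
  have KH: "K * H = 1\<^sub>m n" using mat_mult_left_right_inverse[OF H(1) K] .
  have JT: "transpose_mat J \<in> C" using carriers(6) by simp
  have HJK: "H * J * K \<in> C" using H(1) K(1) carriers(6) by (simp add: assoc)
  have "transpose_mat J * (H * J * K) = (transpose_mat J * H * J) * K"
    using H(1) K(1) carriers(6) JT by (simp add: assoc)
  then have "transpose_mat J * (H * J * K) = 1\<^sub>m n" by (simp only: H(2) K(2))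
  then have inv: "(H * J * K) * transpose_mat J = 1\<^sub>m n"
    by (rule mat_mult_left_right_inverse[OF JT HJK])
  have "J * K * transpose_mat J = (K * H) * (J * K * transpose_mat J)"
    by (simp only: KH left_mult_one_mat[OF mult_carrier_mat[OF mult_carrier_mat[OF carriers(6) K(1)] JT]])
  also have "\<dots> = K * ((H * J * K) * transpose_mat J)"
    using H(1) K(1) carriers(6) JT by (simp add: assoc)
  also have "\<dots> = K" unfolding inv using K(1) by simp
  finally have "J * K * transpose_mat J = K" .
  then show ?thesis
    using compress_mult[OF H(1) K(1) refl form_kill(1)[OF H] dual_form_kill[OF K(1)]]
    by (simp only: K(2) compress_one)
qed

text \<open>In the application \<open>S'\<close> is the adjoint of \<open>S\<close>. It is kept as a separate matrix with its own
  intertwining property, so that the argument involves no field automorphism.\<close>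

lemma compress_isometry:
  assumes H: "H \<in> C" "transpose_mat J * H * J = H"
    and S: "S \<in> C" "J * S * J = S" and S': "S' \<in> C" "transpose_mat J * S' * transpose_mat J = S'"
    and iso: "S' * H * S = H"
  shows "compress S' * compress H * compress S = compress H"
proof -
  have "E0 * (H * S * P) = (E0 * H) * (S * P)"
    using H(1) S(1) carriers by (simp add: assoc)
  also have "\<dots> = (E0 * H * E2) * (S * P)" by (rule arg_cong[OF form_kill(2)[OF H]])
  also have "\<dots> = (E0 * H) * (E2 * (S * P))"
    using H(1) S(1) carriers by (simp add: assoc)
  also have "\<dots> = 0\<^sub>m n m" using inverted_kill(2)[OF S] H(1) carriers by (simp add: assoc)
  finally have *: "E0 * (H * S * P) = 0\<^sub>m n m" .
  have "compress H = compress (S' * (H * S))"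
    using iso H(1) S(1) S'(1) by (simp add: assoc)
  also have "\<dots> = compress S' * compress (H * S)"
    by (rule compress_mult[OF S'(1) _ _ dual_inverted_kill[OF S'] *]) (use H(1) S(1) in auto)
  also have "compress (H * S) = compress H * compress S"
    by (rule compress_mult[OF H(1) S(1) refl form_kill(1)[OF H] inverted_kill(2)[OF S]])
  finally show ?thesis
    using compress_carrier[OF S(1)] compress_carrier[OF S'(1)] compress_carrier[OF H(1)]
    by (simp add: assoc_mult_mat[of _ m m _ m _ m])
qed

lemma compress_unipotent_isometry:
  assumes H: "H \<in> C" "transpose_mat J * H * J = H"
  shows "transpose_mat (compress J) * compress H * compress J = compress H"
proof -
  have JT: "transpose_mat J \<in> C" using carriers(6) by simp
  have "E0 * (H * J * P) = (E0 * H) * (J * P)"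
    using H(1) carriers by (simp add: assoc)
  also have "\<dots> = (E0 * H * E2) * (J * P)" by (rule arg_cong[OF form_kill(2)[OF H]])
  also have "\<dots> = (E0 * H) * (E2 * (J * P))"
    using H(1) carriers by (simp add: assoc)
  also have "\<dots> = 0\<^sub>m n m" using H(1) carriers by (simp add: J_kill assoc)
  finally have *: "E0 * (H * J * P) = 0\<^sub>m n m" .
  have "transpose_mat J * E2 = transpose_mat (E2 * J)"
    using carriers E2_symmetric by (simp add: transpose_mult[of _ n n _ n] del: transpose_J)
  then have JE: "Q * (transpose_mat J * E2) = 0\<^sub>m m n" by (simp add: E2_J layer_simps)
  have cJT: "compress (transpose_mat J) = transpose_mat (compress J)"
  proof -
    have "transpose_mat (compress J) = Q * transpose_mat (Q * J)"
      by (rule transpose_mult[of _ m n _ m]) (use carriers in \<open>auto simp: assoc\<close>)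
    also have "transpose_mat (Q * J) = transpose_mat J * P"
      using transpose_mult[OF carriers(2,6)] by simp
    also have "Q * (transpose_mat J * P) = compress (transpose_mat J)"
      using carriers JT by (simp add: assoc)
    finally show ?thesis by simp
  qed
  have "compress H = compress (transpose_mat J * (H * J))"
    using H JT carriers(6) by (simp add: assoc)
  also have "\<dots> = compress (transpose_mat J) * compress (H * J)"
    by (rule compress_mult[OF JT _ _ JE *]) (use H(1) carriers(6) in auto)
  also have "compress (H * J) = compress H * compress J"
    by (rule compress_mult[OF H(1) carriers(6) refl form_kill(1)[OF H] J_kill(2)])
  finally show ?thesis
    using compress_carrier[OF H(1)] compress_carrier[OF carriers(6)] compress_carrier[OF JT]
    by (simp add: cJT assoc_mult_mat[of _ m m _ m _ m])
qed

end

section \<open>Direct sums of compressions\<close>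

definition direct_sum :: "'a :: zero mat \<Rightarrow> 'a mat \<Rightarrow> 'a mat" where
  "direct_sum A B = four_block_mat A (0\<^sub>m (dim_row A) (dim_col B)) (0\<^sub>m (dim_row B) (dim_col A)) B"

lemma direct_sum_carrier:
  "A \<in> carrier_mat a b \<Longrightarrow> B \<in> carrier_mat c d \<Longrightarrow> direct_sum A B \<in> carrier_mat (a + c) (b + d)"
  by (auto simp: direct_sum_def)

lemma direct_sum_mult:
  fixes A B A' B' :: "'a :: comm_ring_1 mat"
  assumes "A \<in> carrier_mat a b" "A' \<in> carrier_mat b c" "B \<in> carrier_mat d e" "B' \<in> carrier_mat e f"
  shows "direct_sum A B * direct_sum A' B' = direct_sum (A * A') (B * B')"
  using assms unfolding direct_sum_def
  by (subst mult_four_block_mat[of _ a b _ e _ d _ _ c _ f]) auto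

lemma direct_sum_add:
  fixes A B A' B' :: "'a :: comm_ring_1 mat"
  assumes "A \<in> carrier_mat a b" "A' \<in> carrier_mat a b" "B \<in> carrier_mat c d" "B' \<in> carrier_mat c d"
  shows "direct_sum A B + direct_sum A' B' = direct_sum (A + A') (B + B')"
  using assms unfolding direct_sum_def
  by (subst add_four_block_mat[of _ a b _ d _ c]) auto

lemma direct_sum_transpose:
  "transpose_mat (direct_sum A B) = direct_sum (transpose_mat A) (transpose_mat B)"
  unfolding direct_sum_def
  by (subst transpose_four_block_mat[of _ "dim_row A" "dim_col A" _ "dim_col B" _ "dim_row B"]) auto

lemma direct_sum_one: "direct_sum (1\<^sub>m a) (1\<^sub>m b) = 1\<^sub>m (a + b)"
  by (auto simp: direct_sum_def)

lemma direct_sum_zero: "direct_sum (0\<^sub>m a b) (0\<^sub>m c d) = 0\<^sub>m (a + c) (b + d)"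
  by (auto simp: direct_sum_def)

lemma direct_sum_pow:
  fixes A B :: "'a :: comm_ring_1 mat"
  assumes "A \<in> carrier_mat a a" "B \<in> carrier_mat b b"
  shows "direct_sum A B ^\<^sub>m k = direct_sum (A ^\<^sub>m k) (B ^\<^sub>m k)"
  using assms pow_four_block_mat[OF assms, of k] by (auto simp: direct_sum_def)

lemma jordan_matrix_Cons: "jordan_matrix ((n, a) # n_as) = direct_sum (jordan_block n a) (jordan_matrix n_as)"
  by (simp add: jordan_matrix_def direct_sum_def Let_def)

lemma socle_projection_direct_sum:
  assumes 1: "socle_projection a r N E" and 2: "socle_projection b r M D"
  shows "socle_projection (a + b) r (direct_sum N M) (direct_sum E D)"
proof -
  have C: "N \<in> carrier_mat a a" "E \<in> carrier_mat a a" "M \<in> carrier_mat b b" "D \<in> carrier_mat b b"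
    "N * E = 0\<^sub>m a a" "M * D = 0\<^sub>m b b"
    using 1 2 by (auto simp: socle_projection_def)
  obtain F1 where F1: "F1 \<in> carrier_mat a a" "E = N ^\<^sub>m r * F1"
    using 1 unfolding socle_projection_def by blast
  obtain G1 where G1: "G1 \<in> carrier_mat a a" "N ^\<^sub>m r = E * N ^\<^sub>m r + G1 * N ^\<^sub>m Suc r"
    using 1 unfolding socle_projection_def by blast
  obtain F2 where F2: "F2 \<in> carrier_mat b b" "D = M ^\<^sub>m r * F2"
    using 2 unfolding socle_projection_def by blast
  obtain G2 where G2: "G2 \<in> carrier_mat b b" "M ^\<^sub>m r = D * M ^\<^sub>m r + G2 * M ^\<^sub>m Suc r"
    using 2 unfolding socle_projection_def by blast
  have pows: "N ^\<^sub>m k \<in> carrier_mat a a" "M ^\<^sub>m k \<in> carrier_mat b b" for k using C by auto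
  note dm = direct_sum_mult[of _ a a _ a _ b b _ b]
  show ?thesis
    unfolding socle_projection_def
  proof (intro conjI bexI)
    show "direct_sum E D = direct_sum N M ^\<^sub>m r * direct_sum F1 F2"
      using C pows F1(1) F2(1) by (simp add: direct_sum_pow dm del: pow_mat.simps flip: F1(2) F2(2))
    have "direct_sum E D * direct_sum N M ^\<^sub>m r + direct_sum G1 G2 * direct_sum N M ^\<^sub>m Suc r
        = direct_sum (E * N ^\<^sub>m r + G1 * N ^\<^sub>m Suc r) (D * M ^\<^sub>m r + G2 * M ^\<^sub>m Suc r)"
      unfolding direct_sum_pow[OF C(1,3)] dm[OF C(2) pows(1) C(4) pows(2)] dm[OF G1(1) pows(1) G2(1) pows(2)]
      by (rule direct_sum_add[of _ a a _ _ b b])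
        (intro mult_carrier_mat[of _ a a] mult_carrier_mat[of _ b b] C pows G1(1) G2(1))+
    then show "direct_sum N M ^\<^sub>m r = direct_sum E D * direct_sum N M ^\<^sub>m r
        + direct_sum G1 G2 * direct_sum N M ^\<^sub>m Suc r"
      unfolding G1(2)[symmetric] G2(2)[symmetric] direct_sum_pow[OF C(1,3)] by simp
  qed (use C F1(1) F2(1) G1(1) G2(1) in \<open>auto simp: direct_sum_carrier dm direct_sum_zero\<close>)
qed

lemma core_compression_direct_sum:
  assumes 1: "core_compression n1 m1 r N1 P1 D1 E1 M1" and 2: "core_compression n2 m2 r N2 P2 D2 E2 M2"
  shows "core_compression (n1 + n2) (m1 + m2) r (direct_sum N1 N2) (direct_sum P1 P2)
    (direct_sum D1 D2) (direct_sum E1 E2) (direct_sum M1 M2)"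
proof -
  note 1 = 1[unfolded core_compression_def] and 2 = 2[unfolded core_compression_def]
  have C: "N1 \<in> carrier_mat n1 n1" "N2 \<in> carrier_mat n2 n2" "P1 \<in> carrier_mat n1 m1" "P2 \<in> carrier_mat n2 m2"
    "D1 \<in> carrier_mat n1 n1" "D2 \<in> carrier_mat n2 n2" "E1 \<in> carrier_mat n1 n1" "E2 \<in> carrier_mat n2 n2"
    using 1 2 by (auto simp: socle_projection_def)
  have T: "transpose_mat P1 \<in> carrier_mat m1 n1" "transpose_mat P2 \<in> carrier_mat m2 n2"
    "P1 * transpose_mat P1 \<in> carrier_mat n1 n1" "P2 * transpose_mat P2 \<in> carrier_mat n2 n2"
    "transpose_mat P1 * N1 \<in> carrier_mat m1 n1" "transpose_mat P2 * N2 \<in> carrier_mat m2 n2"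
    "D1 + P1 * transpose_mat P1 \<in> carrier_mat n1 n1" "D2 + P2 * transpose_mat P2 \<in> carrier_mat n2 n2"
    using C by (auto intro!: mult_carrier_mat[of _ n1 m1] mult_carrier_mat[of _ n2 m2]
        mult_carrier_mat[of _ m1 n1] mult_carrier_mat[of _ m2 n2])
  show ?thesis
    unfolding core_compression_def
  proof (intro conjI)
    show "direct_sum P1 P2 \<in> carrier_mat (n1 + n2) (m1 + m2)" using C direct_sum_carrier by blast
    show "socle_projection (n1 + n2) r (direct_sum N1 N2) (direct_sum D1 D2)"
      using 1 2 by (intro socle_projection_direct_sum) auto
    show "socle_projection (n1 + n2) r (transpose_mat (direct_sum N1 N2)) (direct_sum E1 E2)"
      unfolding direct_sum_transpose using 1 2 by (intro socle_projection_direct_sum) auto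
    show "direct_sum D1 D2 + direct_sum P1 P2 * transpose_mat (direct_sum P1 P2) + direct_sum E1 E2 = 1\<^sub>m (n1 + n2)"
      using 1 2 unfolding direct_sum_transpose direct_sum_mult[OF C(3) T(1) C(4) T(2)]
        direct_sum_add[OF C(5) T(3) C(6) T(4)] direct_sum_add[OF T(7) C(7) T(8) C(8)]
      by (simp add: direct_sum_one)
    show "transpose_mat (direct_sum P1 P2) * direct_sum P1 P2 = 1\<^sub>m (m1 + m2)"
      using 1 2 unfolding direct_sum_transpose direct_sum_mult[OF T(1) C(3) T(2) C(4)]
      by (simp add: direct_sum_one)
    show "transpose_mat (direct_sum P1 P2) * direct_sum D1 D2 = 0\<^sub>m (m1 + m2) (n1 + n2)"
      using 1 2 unfolding direct_sum_transpose direct_sum_mult[OF T(1) C(5) T(2) C(6)]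
      by (simp add: direct_sum_zero)
    show "transpose_mat (direct_sum P1 P2) * direct_sum E1 E2 = 0\<^sub>m (m1 + m2) (n1 + n2)"
      using 1 2 unfolding direct_sum_transpose direct_sum_mult[OF T(1) C(7) T(2) C(8)]
      by (simp add: direct_sum_zero)
    show "transpose_mat (direct_sum P1 P2) * direct_sum N1 N2 * direct_sum P1 P2 = direct_sum M1 M2"
      using 1 2 unfolding direct_sum_transpose direct_sum_mult[OF T(1) C(1) T(2) C(2)]
        direct_sum_mult[OF T(5) C(3) T(6) C(4)]
      by simp
  qed (use 1 2 in \<open>simp_all add: direct_sum_transpose\<close>)
qed

section \<open>Compression of Jordan matrices\<close>

text \<open>Zero-one matrices given by relations. All blocks below are of this form, and products of partial
  permutations become compositions of relations (\<open>rel_mat_mult\<close>), which leaves plain arithmetic of indices.\<close>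

definition rel_mat :: "nat \<Rightarrow> nat \<Rightarrow> (nat \<Rightarrow> nat \<Rightarrow> bool) \<Rightarrow> 'a :: {zero, one} mat" where
  "rel_mat m n R = mat m n (\<lambda>(i, j). if R i j then 1 else 0)"

lemma rel_mat_carrier [simp]: "rel_mat m n R \<in> carrier_mat m n"
  by (simp add: rel_mat_def)

lemma rel_mat_dim [simp]: "dim_row (rel_mat m n R) = m" "dim_col (rel_mat m n R) = n"
  by (simp_all add: rel_mat_def)

lemma rel_mat_index [simp]: "i < m \<Longrightarrow> j < n \<Longrightarrow> rel_mat m n R $$ (i, j) = (if R i j then 1 else 0)"
  by (simp add: rel_mat_def)

lemma rel_mat_cong:
  "(\<And>i j. i < m \<Longrightarrow> j < n \<Longrightarrow> R i j \<longleftrightarrow> R' i j) \<Longrightarrow> rel_mat m n R = rel_mat m n R'"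
  by (intro eq_matI) auto

lemma transpose_rel_mat: "transpose_mat (rel_mat m n R) = rel_mat n m (\<lambda>i j. R j i)"
  by (intro eq_matI) auto

lemma rel_mat_one: "1\<^sub>m n = rel_mat n n (=)"
  by (intro eq_matI) auto

lemma rel_mat_zero: "0\<^sub>m m n = rel_mat m n (\<lambda>_ _. False)"
  by (intro eq_matI) auto

lemma rel_mat_mult:
  assumes "\<And>i j k k'. i < m \<Longrightarrow> j < p \<Longrightarrow> k < n \<Longrightarrow> k' < n \<Longrightarrow> R i k \<Longrightarrow> Q k j \<Longrightarrow> R i k' \<Longrightarrow> Q k' j \<Longrightarrow> k = k'"
  shows "rel_mat m n R * rel_mat n p Q = (rel_mat m p (\<lambda>i j. \<exists>k<n. R i k \<and> Q k j) :: 'a :: comm_ring_1 mat)"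
proof (rule eq_matI)
  fix i j assume ij: "i < dim_row (rel_mat m p (\<lambda>i j. \<exists>k<n. R i k \<and> Q k j) :: 'a mat)"
    "j < dim_col (rel_mat m p (\<lambda>i j. \<exists>k<n. R i k \<and> Q k j) :: 'a mat)"
  let ?S = "{k \<in> {0..<n}. R i k \<and> Q k j}"
  have "(rel_mat m n R * rel_mat n p Q :: 'a mat) $$ (i, j) = (\<Sum>k = 0..<n. if R i k \<and> Q k j then 1 else 0)"
    using ij by (auto simp: scalar_prod_def intro!: sum.cong)
  also have "\<dots> = of_nat (card ?S)" by (simp add: sum.If_cases Int_def)
  also have "card ?S = (if \<exists>k<n. R i k \<and> Q k j then 1 else 0)"
  proof (cases "\<exists>k<n. R i k \<and> Q k j")
    case True
    then obtain k where k: "k < n" "R i k" "Q k j" by blast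
    then have "?S = {k}" using assms[of i j] ij by auto
    then show ?thesis using True by simp
  next
    case False
    then have "?S = {}" by auto
    then show ?thesis using False by (simp only: card.empty if_False)
  qed
  finally have eq: "(rel_mat m n R * rel_mat n p Q :: 'a mat) $$ (i, j)
    = of_nat (if \<exists>k<n. R i k \<and> Q k j then 1 else 0)" .
  have "i < m" "j < p" using ij by simp_all
  then show "(rel_mat m n R * rel_mat n p Q :: 'a mat) $$ (i, j) = rel_mat m p (\<lambda>i j. \<exists>k<n. R i k \<and> Q k j) $$ (i, j)"
    unfolding eq by (subst rel_mat_index) auto
qed auto

lemma rel_mat_add:
  assumes "\<And>i j. i < m \<Longrightarrow> j < n \<Longrightarrow> \<not> (R i j \<and> Q i j)"
  shows "rel_mat m n R + rel_mat m n Q = (rel_mat m n (\<lambda>i j. R i j \<or> Q i j) :: 'a :: comm_ring_1 mat)"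
  using assms by (intro eq_matI) auto

lemma jordan_block_zero_pow_rel_mat: "(jordan_block n (0 :: 'a :: field)) ^\<^sub>m k = rel_mat n n (\<lambda>i j. j = i + k)"
  unfolding jordan_block_zero_pow by (auto intro!: eq_matI)

lemma jordan_block_zero_rel_mat: "jordan_block n (0 :: 'a :: field) = rel_mat n n (\<lambda>i j. j = i + 1)"
  by (intro eq_matI) auto

lemma transpose_pow:
  assumes "A \<in> carrier_mat n n"
  shows "transpose_mat (A :: 'a :: comm_ring_1 mat) ^\<^sub>m k = transpose_mat (A ^\<^sub>m k)"
proof (induction k)
  case (Suc k)
  have comm: "A * A ^\<^sub>m k = A ^\<^sub>m k * A"
  proof (induction k)
    case (Suc k)
    have "A * A ^\<^sub>m Suc k = (A * A ^\<^sub>m k) * A"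
      using assms by (simp add: assoc_mult_mat[of _ n n _ n _ n])
    then show ?case using Suc by simp
  qed (use assms in simp)
  have "transpose_mat A ^\<^sub>m Suc k = transpose_mat (A * A ^\<^sub>m k)"
    using assms Suc by (simp add: transpose_mult[of _ n n _ n])
  then show ?case by (simp add: comm)
qed (use assms in simp)

text \<open>Here the power \<open>r\<close> of the block vanishes, so the block lies in layer 1.\<close>

lemma core_compression_small_block:
  assumes "i \<le> r"
  shows "core_compression i i r (jordan_block i (0 :: 'a :: field)) (1\<^sub>m i) (0\<^sub>m i i) (0\<^sub>m i i) (jordan_block i 0)"
proof -
  have "(jordan_block i (0 :: 'a)) ^\<^sub>m r = 0\<^sub>m i i"
    using assms by (auto simp: jordan_block_zero_pow_rel_mat intro!: eq_matI)
  moreover have "transpose_mat (jordan_block i (0 :: 'a)) ^\<^sub>m r = 0\<^sub>m i i"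
    using calculation by (simp add: transpose_pow[of _ i])
  ultimately show ?thesis
    by (auto simp: core_compression_def socle_projection_def intro!: bexI[of _ "0\<^sub>m i i"])
qed

text \<open>In both socle projections the matrix \<open>G\<close> is the shift in the opposite direction: shifting forth and
  back is the identity except at the end of the block that the projection covers.\<close>

lemma core_compression_large_block:
  assumes "r < i" "1 \<le> r"
  shows "core_compression i (i - 2) r (jordan_block i (0 :: 'a :: field))
    (rel_mat i (i - 2) (\<lambda>a b. a = b + 1)) (rel_mat i i (\<lambda>a b. a = 0 \<and> b = 0))
    (rel_mat i i (\<lambda>a b. a = i - 1 \<and> b = i - 1)) (jordan_block (i - 2) 0)"
proof -
  let ?N = "jordan_block i (0 :: 'a)" and ?E0 = "rel_mat i i (\<lambda>a b. a = 0 \<and> b = 0) :: 'a mat"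
  let ?E2 = "rel_mat i i (\<lambda>a b. a = i - 1 \<and> b = i - 1) :: 'a mat"
  let ?P = "rel_mat i (i - 2) (\<lambda>a b. a = b + 1) :: 'a mat"
  note N = jordan_block_zero_rel_mat and Np = jordan_block_zero_pow_rel_mat
  have NT: "transpose_mat ?N = rel_mat i i (\<lambda>a b. a = b + 1)" by (simp add: N transpose_rel_mat)
  have NTp: "transpose_mat ?N ^\<^sub>m k = rel_mat i i (\<lambda>a b. a = b + k)" for k
    by (simp add: transpose_pow[of _ i] Np transpose_rel_mat)
  have "socle_projection i r ?N ?E0"
    unfolding socle_projection_def
  proof (intro conjI bexI)
    show "?N * ?E0 = 0\<^sub>m i i"
      unfolding N by (subst rel_mat_mult) (auto simp: rel_mat_zero intro!: rel_mat_cong)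
    show "?E0 = ?N ^\<^sub>m r * rel_mat i i (\<lambda>a b. a = r \<and> b = 0)"
      unfolding Np using assms by (subst rel_mat_mult) (auto intro!: rel_mat_cong)
    show "?N ^\<^sub>m r = ?E0 * ?N ^\<^sub>m r + transpose_mat ?N * ?N ^\<^sub>m Suc r"
      unfolding Np NT using assms
      apply (subst rel_mat_mult, force)
      apply (subst rel_mat_mult, force)
      apply (subst rel_mat_add, force)
      apply (rule rel_mat_cong)
      subgoal for a b by (cases a) auto
      done
  qed auto
  moreover have "socle_projection i r (transpose_mat ?N) ?E2"
    unfolding socle_projection_def
  proof (intro conjI bexI)
    show "transpose_mat ?N * ?E2 = 0\<^sub>m i i"
      unfolding NT by (subst rel_mat_mult) (auto simp: rel_mat_zero intro!: rel_mat_cong)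
    show "?E2 = transpose_mat ?N ^\<^sub>m r * rel_mat i i (\<lambda>a b. a + r = i - 1 \<and> b = i - 1)"
      unfolding NTp using assms
      apply (subst rel_mat_mult, force)
      apply (rule rel_mat_cong)
      subgoal for a b by (auto intro!: exI[of _ "i - 1 - r"])
      done
    show "transpose_mat ?N ^\<^sub>m r = ?E2 * transpose_mat ?N ^\<^sub>m r + ?N * transpose_mat ?N ^\<^sub>m Suc r"
      unfolding NTp unfolding N using assms
      apply (subst rel_mat_mult, force)
      apply (subst rel_mat_mult, force)
      apply (subst rel_mat_add, force)
      apply (rule rel_mat_cong)
      apply auto
      done
  qed auto
  moreover have "?E0 + ?P * transpose_mat ?P + ?E2 = 1\<^sub>m i"
    unfolding transpose_rel_mat using assms
    apply (subst rel_mat_mult, force)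
    apply (subst rel_mat_add, force)
    apply (subst rel_mat_add, force)
    unfolding rel_mat_one
    apply (rule rel_mat_cong)
    subgoal for a b by (cases a; cases b) auto
    done
  moreover have "transpose_mat ?P * ?P = 1\<^sub>m (i - 2)"
    unfolding transpose_rel_mat rel_mat_one by (subst rel_mat_mult) (auto intro!: rel_mat_cong)
  moreover have "transpose_mat ?P * ?E0 = 0\<^sub>m (i - 2) i"
    unfolding transpose_rel_mat rel_mat_zero by (subst rel_mat_mult) (auto intro!: rel_mat_cong)
  moreover have "transpose_mat ?P * ?E2 = 0\<^sub>m (i - 2) i"
    unfolding transpose_rel_mat rel_mat_zero by (subst rel_mat_mult) (auto intro!: rel_mat_cong)
  moreover have "transpose_mat ?P * ?N * ?P = jordan_block (i - 2) 0"
    unfolding transpose_rel_mat N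
    apply (subst rel_mat_mult, force)
    apply (subst rel_mat_mult, force)
    apply (rule rel_mat_cong)
    apply auto
    done
  moreover have "transpose_mat ?E0 = ?E0" "transpose_mat ?E2 = ?E2"
    unfolding transpose_rel_mat by (auto intro!: rel_mat_cong)
  ultimately show ?thesis unfolding core_compression_def by simp
qed

definition zero_one_mat :: "'a :: {zero, one} mat \<Rightarrow> bool" where
  "zero_one_mat A \<longleftrightarrow> (\<forall>i < dim_row A. \<forall>j < dim_col A. A $$ (i, j) = 0 \<or> A $$ (i, j) = 1)"

lemma zero_one_direct_sum: "zero_one_mat A \<Longrightarrow> zero_one_mat B \<Longrightarrow> zero_one_mat (direct_sum A B)"
  by (auto simp: zero_one_mat_def direct_sum_def)

definition nilpotent_jordan_matrix :: "nat list \<Rightarrow> 'a :: {zero, one} mat" where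
  "nilpotent_jordan_matrix ns = jordan_matrix (map (\<lambda>n. (n, 0)) ns)"

text \<open>Blocks of size \<open>2\<close> leave a block of size \<open>0\<close>; these blocks have no rows and are dropped by
  \<open>jordan_matrix_filter_nonzero\<close>. That \<open>P\<close> has entries 0 and 1 is recorded because it makes the adjoint of \<open>P\<close>
  its transpose.\<close>

lemma ex_core_compression:
  assumes "1 \<le> r"
  shows "\<exists>P E0 E2. zero_one_mat P \<and>
    core_compression (sum_list ns) (sum_list (map (\<lambda>i. if Suc r \<le> i then i - 2 else i) ns)) r
      (nilpotent_jordan_matrix ns) P E0 E2
      (nilpotent_jordan_matrix (map (\<lambda>i. if Suc r \<le> i then i - 2 else i) ns) :: 'a :: field mat)"
proof (induction ns)
  case Nil
  have "nilpotent_jordan_matrix [] = jordan_block 0 (0 :: 'a)"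
    by (intro eq_matI) (auto simp: nilpotent_jordan_matrix_def jordan_matrix_def)
  moreover have "zero_one_mat (1\<^sub>m 0 :: 'a mat)" by (simp add: zero_one_mat_def)
  ultimately show ?case using core_compression_small_block[of 0 r, where 'a = 'a] by auto
next
  case (Cons i ns)
  let ?s = "\<lambda>i::nat. if Suc r \<le> i then i - 2 else i"
  from Cons obtain P E0 E2 where ns: "zero_one_mat P"
    "core_compression (sum_list ns) (sum_list (map ?s ns)) r (nilpotent_jordan_matrix ns) P E0 E2
      (nilpotent_jordan_matrix (map ?s ns) :: 'a mat)" by blast
  have "\<exists>P E0 E2. zero_one_mat P \<and> core_compression i (?s i) r (jordan_block i 0) P E0 E2 (jordan_block (?s i) (0 :: 'a))"
  proof (cases "Suc r \<le> i")
    case True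
    then have s: "?s i = i - 2" and "r < i" by auto
    have zo: "zero_one_mat (rel_mat i (i - 2) (\<lambda>a b. a = b + 1) :: 'a mat)"
      by (simp add: zero_one_mat_def)
    show ?thesis
      unfolding s using zo core_compression_large_block[OF \<open>r < i\<close> assms, where 'a = 'a] by blast
  next
    case False
    then have s: "?s i = i" and "i \<le> r" by auto
    have zo: "zero_one_mat (1\<^sub>m i :: 'a mat)" by (auto simp: zero_one_mat_def)
    show ?thesis
      unfolding s using zo core_compression_small_block[OF \<open>i \<le> r\<close>, where 'a = 'a] by blast
  qed
  then obtain P' E0' E2' where i: "zero_one_mat P'"
    "core_compression i (?s i) r (jordan_block i 0) P' E0' E2' (jordan_block (?s i) (0 :: 'a))" by blast
  have Cons_eq: "nilpotent_jordan_matrix (j # js) = (direct_sum (jordan_block j 0) (nilpotent_jordan_matrix js) :: 'a mat)"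
    for j js by (simp add: nilpotent_jordan_matrix_def jordan_matrix_Cons)
  show ?case
    unfolding list.map sum_list.Cons Cons_eq
    using core_compression_direct_sum[OF i(2) ns(2)] zero_one_direct_sum[OF i(1) ns(1)] by blast
qed

section \<open>Jordan matrices of unipotent matrices\<close>

text \<open>Adding 1 to all eigenvalues adds the identity; this relates unipotent to nilpotent Jordan matrices.\<close>

lemma jordan_matrix_shift:
  "jordan_matrix (map (\<lambda>(n, a). (n, a + 1)) n_as) =
     1\<^sub>m (sum_list (map fst n_as)) + (jordan_matrix n_as :: 'a :: comm_ring_1 mat)"
proof (induction n_as)
  case (Cons p n_as)
  obtain n a where p: "p = (n, a)" by force
  have "jordan_block n (a + 1) = 1\<^sub>m n + jordan_block n a"
    by (intro eq_matI) (auto simp: jordan_block_def)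
  then show ?case
    using Cons direct_sum_add[of "1\<^sub>m n" n n "jordan_block n a" "1\<^sub>m (sum_list (map fst n_as))"
        "sum_list (map fst n_as)" "sum_list (map fst n_as)" "jordan_matrix n_as"]
    by (simp add: p jordan_matrix_Cons direct_sum_one)
qed (auto simp: jordan_matrix_def)

lemma direct_sum_eq_zeroD:
  assumes "direct_sum A B = 0\<^sub>m n m" "A \<in> carrier_mat a b" "B \<in> carrier_mat c d"
  shows "A = 0\<^sub>m a b" "B = 0\<^sub>m c d"
proof -
  have dims: "n = a + c" "m = b + d"
    using arg_cong[OF assms(1), of dim_row] arg_cong[OF assms(1), of dim_col] assms(2,3)
    by (auto simp: direct_sum_def)
  have ent: "direct_sum A B $$ (i, j) = 0" if "i < a + c" "j < b + d" for i j
    using that dims by (simp add: assms(1))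
  show "A = 0\<^sub>m a b"
  proof (rule eq_matI)
    fix i j assume "i < dim_row (0\<^sub>m a b :: 'a mat)" "j < dim_col (0\<^sub>m a b :: 'a mat)"
    then show "A $$ (i, j) = 0\<^sub>m a b $$ (i, j)"
      using ent[of i j] assms(2,3) by (auto simp: direct_sum_def)
  qed (use assms in auto)
  show "B = 0\<^sub>m c d"
  proof (rule eq_matI)
    fix i j assume "i < dim_row (0\<^sub>m c d :: 'a mat)" "j < dim_col (0\<^sub>m c d :: 'a mat)"
    then show "B $$ (i, j) = 0\<^sub>m c d $$ (i, j)"
      using ent[of "a + i" "b + j"] assms(2,3) by (auto simp: direct_sum_def)
  qed (use assms in auto)
qed

lemma nilpotent_jordan_matrixD:
  fixes n_as :: "(nat \<times> 'a :: field) list"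
  assumes "jordan_matrix n_as ^\<^sub>m r = 0\<^sub>m n n" "(k, a) \<in> set n_as" "k \<noteq> 0"
  shows "a = 0"
  using assms
proof (induction n_as arbitrary: n)
  case (Cons p n_as)
  obtain m b where p: "p = (m, b)" by force
  let ?s = "sum_list (map fst n_as)"
  have "direct_sum (jordan_block m b ^\<^sub>m r) (jordan_matrix n_as ^\<^sub>m r) = 0\<^sub>m n n"
    using Cons.prems(1) unfolding p jordan_matrix_Cons
    by (subst (asm) direct_sum_pow[of _ m _ ?s]) auto
  note zero = direct_sum_eq_zeroD[OF this, of m m ?s ?s]
  have zero: "jordan_block m b ^\<^sub>m r = 0\<^sub>m m m" "jordan_matrix n_as ^\<^sub>m r = 0\<^sub>m ?s ?s"
    by (rule zero; simp)+
  show ?case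
  proof (cases "(k, a) \<in> set n_as")
    case True
    then show ?thesis using Cons.IH[OF zero(2)] Cons.prems by blast
  next
    case False
    then have ka: "k = m" "a = b" using Cons.prems p by auto
    then have "m > 0" using Cons.prems by simp
    then have "(jordan_block m b ^\<^sub>m r) $$ (0, 0) = b ^ r" by (simp add: jordan_block_pow)
    then have "b ^ r = 0" using \<open>m > 0\<close> by (simp add: zero)
    then show ?thesis using ka by simp
  qed
qed simp

lemma nilpotent_jordan_matrix_pow:
  assumes "\<forall>n \<in> set ns. n \<le> r"
  shows "(nilpotent_jordan_matrix ns :: 'a :: field mat) ^\<^sub>m r = 0\<^sub>m (sum_list ns) (sum_list ns)"
  using assms
proof (induction ns)
  case (Cons n ns)
  have nj: "nilpotent_jordan_matrix ns \<in> carrier_mat (sum_list ns) (sum_list ns)"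
    using jordan_matrix_carrier[of "map (\<lambda>n. (n, 0)) ns"]
    by (simp add: nilpotent_jordan_matrix_def comp_def)
  have "nilpotent_jordan_matrix (n # ns) = direct_sum (jordan_block n 0) (nilpotent_jordan_matrix ns :: 'a mat)"
    by (simp add: nilpotent_jordan_matrix_def jordan_matrix_Cons)
  moreover have "jordan_block n (0 :: 'a) ^\<^sub>m r = 0\<^sub>m n n"
    using Cons.prems by (auto simp: jordan_block_zero_pow_rel_mat intro!: eq_matI)
  ultimately show ?case
    using Cons direct_sum_pow[of "jordan_block n (0 :: 'a)" n, OF _ nj] by (simp add: direct_sum_zero)
qed (auto simp: nilpotent_jordan_matrix_def jordan_matrix_def pow_carrier_mat[of _ 0] intro!: eq_matI)

lemma unipotent_mat_similar:
  fixes g h :: "'a :: field mat"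
  assumes g: "g \<in> carrier_mat n n" and sim: "similar_mat g h" and u: "unipotent_mat n h"
  shows "unipotent_mat n g"
proof -
  obtain P Q where wit: "similar_mat_wit g h P Q" using sim by (auto simp: similar_mat_def)
  note w = similar_mat_witD2[OF g wit]
  obtain r where r: "(h - 1\<^sub>m n) ^\<^sub>m r = 0\<^sub>m n n" using u by (auto simp: unipotent_mat_def)
  have hC: "h - 1\<^sub>m n \<in> carrier_mat n n" using w by auto
  have "P * (h - 1\<^sub>m n) = P * h - P"
    using w by (simp add: mult_minus_distrib_mat[of _ n n _ n])
  then have "P * (h - 1\<^sub>m n) * Q = P * h * Q - P * Q"
    using w by (simp add: minus_mult_distrib_mat[of _ n n _ _ n])
  then have "similar_mat_wit (g - 1\<^sub>m n) (h - 1\<^sub>m n) P Q"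
    using w g by (auto simp: similar_mat_wit_def Let_def)
  from similar_mat_wit_pow[OF this, of r]
  have "(g - 1\<^sub>m n) ^\<^sub>m r = P * (0\<^sub>m n n) * Q"
    unfolding r similar_mat_wit_def Let_def by simp
  then have "(g - 1\<^sub>m n) ^\<^sub>m r = 0\<^sub>m n n" using w by simp
  then show ?thesis by (auto simp: unipotent_mat_def)
qed

text \<open>The conjugating matrix is the permutation matrix that exchanges the two groups of coordinates.\<close>

lemma direct_sum_commute_similar:
  fixes A B :: "'a :: comm_ring_1 mat"
  assumes A: "A \<in> carrier_mat a a" and B: "B \<in> carrier_mat b b"
  shows "similar_mat (direct_sum A B) (direct_sum B A)"
proof -
  define P :: "'a mat" where "P = four_block_mat (0\<^sub>m a b) (1\<^sub>m a) (1\<^sub>m b) (0\<^sub>m b a)"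
  define Q :: "'a mat" where "Q = four_block_mat (0\<^sub>m b a) (1\<^sub>m b) (1\<^sub>m a) (0\<^sub>m a b)"
  have "P * Q = 1\<^sub>m (a + b)"
    unfolding P_def Q_def by (subst mult_four_block_mat[of _ a b _ a _ b _ _ a _ b]) auto
  moreover have "Q * P = 1\<^sub>m (a + b)"
    unfolding P_def Q_def
    by (subst mult_four_block_mat[of _ b a _ b _ a _ _ b _ a]) (auto simp: add.commute)
  moreover have "P * direct_sum B A = four_block_mat (0\<^sub>m a b) A B (0\<^sub>m b a)"
    unfolding P_def direct_sum_def using A B
    by (subst mult_four_block_mat[of _ a b _ a _ b _ _ b _ a]) auto
  moreover have "four_block_mat (0\<^sub>m a b) A B (0\<^sub>m b a) * Q = direct_sum A B"
    unfolding Q_def direct_sum_def using A B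
    by (subst mult_four_block_mat[of _ a b _ a _ b _ _ a _ b]) auto
  moreover have "{direct_sum A B, direct_sum B A, P, Q} \<subseteq> carrier_mat (a + b) (a + b)"
    using direct_sum_carrier[OF A B] direct_sum_carrier[OF B A]
    by (auto simp: P_def Q_def add.commute)
  ultimately show ?thesis by (intro similar_matI[of _ _ P Q "a + b"]) auto
qed

lemma direct_sum_similar:
  fixes A B :: "'a :: comm_ring_1 mat"
  assumes "similar_mat A A'" "similar_mat B B'" "A \<in> carrier_mat a a" "B \<in> carrier_mat b b"
  shows "similar_mat (direct_sum A B) (direct_sum A' B')"
proof -
  have "A' \<in> carrier_mat a a" "B' \<in> carrier_mat b b"
    using similar_matD[OF assms(1)] similar_matD[OF assms(2)] assms(3,4) by auto
  then show ?thesis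
    using similar_mat_four_block_0_0[OF assms] assms(3,4) by (auto simp: direct_sum_def)
qed

lemma direct_sum_assoc: "direct_sum (direct_sum A B) D = direct_sum A (direct_sum B D)"
  unfolding direct_sum_def by (rule assoc_four_block_mat[symmetric])

lemma jordan_matrix_move_front:
  fixes p :: "nat \<times> 'a :: comm_ring_1"
  shows "similar_mat (jordan_matrix (xs @ p # ys)) (jordan_matrix (p # xs @ ys))"
proof (induction xs)
  case Nil
  show ?case using similar_mat_refl[OF jordan_matrix_carrier] by simp
next
  case (Cons x xs)
  obtain n a where x: "x = (n, a)" by force
  obtain m b where p: "p = (m, b)" by force
  let ?A = "jordan_block n a" and ?B = "jordan_block m b" and ?D = "jordan_matrix (xs @ ys)"
  have "similar_mat (jordan_matrix ((x # xs) @ p # ys)) (direct_sum ?A (direct_sum ?B ?D))"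
    using direct_sum_similar[OF similar_mat_refl[OF jordan_block_carrier] Cons jordan_block_carrier jordan_matrix_carrier]
    by (simp add: x p jordan_matrix_Cons)
  also have "direct_sum ?A (direct_sum ?B ?D) = direct_sum (direct_sum ?A ?B) ?D"
    by (simp add: direct_sum_assoc)
  finally have 1: "similar_mat (jordan_matrix ((x # xs) @ p # ys)) (direct_sum (direct_sum ?A ?B) ?D)" .
  have "similar_mat (direct_sum (direct_sum ?A ?B) ?D) (direct_sum (direct_sum ?B ?A) ?D)"
    by (rule direct_sum_similar[OF direct_sum_commute_similar[OF jordan_block_carrier jordan_block_carrier]
          similar_mat_refl[OF jordan_matrix_carrier] direct_sum_carrier[OF jordan_block_carrier jordan_block_carrier]
          jordan_matrix_carrier])
  then show ?case
    using similar_mat_trans[OF 1] by (simp add: x p jordan_matrix_Cons direct_sum_assoc)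
qed

text \<open>A Jordan type is a multiset of sizes while a Jordan matrix depends on a list, so the order of the blocks has to be
  immaterial up to similarity.\<close>

lemma jordan_matrix_similar_mset:
  fixes xs :: "(nat \<times> 'a :: comm_ring_1) list"
  assumes "mset xs = mset ys"
  shows "similar_mat (jordan_matrix xs) (jordan_matrix ys)"
  using assms
proof (induction xs arbitrary: ys)
  case Nil
  then show ?case using similar_mat_refl[OF jordan_matrix_carrier] by simp
next
  case (Cons x xs)
  then have "x \<in> set ys" by (metis list.set_intros(1) set_mset_mset)
  then obtain us vs where ys: "ys = us @ x # vs" by (meson split_list)
  then have "mset xs = mset (us @ vs)" using Cons.prems by simp
  then have IH: "similar_mat (jordan_matrix xs) (jordan_matrix (us @ vs))" by (rule Cons.IH)
  obtain n a where x: "x = (n, a)" by force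
  have "similar_mat (jordan_matrix (x # xs)) (jordan_matrix (x # us @ vs))"
    unfolding x jordan_matrix_Cons
    by (rule direct_sum_similar[OF similar_mat_refl IH, of _ n]) auto
  then show ?case
    unfolding ys using similar_mat_trans similar_mat_sym[OF jordan_matrix_move_front] by blast
qed

lemma jordan_matrix_filter_nonzero:
  "jordan_matrix (filter (\<lambda>p. 0 < fst p) n_as) = (jordan_matrix n_as :: 'a :: comm_ring_1 mat)"
proof (induction n_as)
  case (Cons p n_as)
  obtain n a where p: "p = (n, a)" by force
  have "direct_sum (jordan_block 0 a) X = X" for X :: "'a mat"
    by (intro eq_matI) (auto simp: direct_sum_def)
  then show ?case using Cons by (auto simp: p jordan_matrix_Cons)
qed simp

definition unipotent_jordan_matrix :: "nat list \<Rightarrow> 'a :: {zero, one} mat" where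
  "unipotent_jordan_matrix ns = jordan_matrix (map (\<lambda>n. (n, 1)) ns)"

lemma unipotent_jordan_matrix_eq:
  "unipotent_jordan_matrix ns = 1\<^sub>m (sum_list ns) + (nilpotent_jordan_matrix ns :: 'a :: field mat)"
  using jordan_matrix_shift[of "map (\<lambda>n. (n, 0 :: 'a)) ns"]
  by (simp add: unipotent_jordan_matrix_def nilpotent_jordan_matrix_def comp_def)

lemma nilpotent_jordan_matrix_carrier [simp]:
  "nilpotent_jordan_matrix ns \<in> carrier_mat (sum_list ns) (sum_list ns)"
  using jordan_matrix_carrier[of "map (\<lambda>n. (n, 0)) ns"]
  by (simp add: nilpotent_jordan_matrix_def comp_def)

lemma unipotent_jordan_matrix_carrier [simp]:
  "unipotent_jordan_matrix ns \<in> carrier_mat (sum_list ns) (sum_list ns)"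
  using jordan_matrix_carrier[of "map (\<lambda>n. (n, 1)) ns"]
  by (simp add: unipotent_jordan_matrix_def comp_def)

lemma jordan_nf_unipotent:
  fixes g :: "'a :: field mat"
  assumes g: "g \<in> carrier_mat n n" "unipotent_mat n g" and jnf: "jordan_nf g n_as"
  shows "n_as = map (\<lambda>k. (k, 1)) (map fst n_as)"
proof -
  have sim: "similar_mat g (jordan_matrix n_as)" and nz: "0 \<notin> fst ` set n_as"
    using jnf by (auto simp: jordan_nf_def)
  have J: "jordan_matrix n_as \<in> carrier_mat n n" using similar_matD[OF sim] g(1) by auto
  then have n: "n = sum_list (map fst n_as)" by auto
  have "unipotent_mat n (jordan_matrix n_as)"
    using unipotent_mat_similar[OF J similar_mat_sym[OF sim] g(2)] .
  then obtain r where r: "(jordan_matrix n_as - 1\<^sub>m n) ^\<^sub>m r = 0\<^sub>m n n" by (auto simp: unipotent_mat_def)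
  define m_as where "m_as = map (\<lambda>(k, a). (k, a - 1)) n_as"
  have m: "map (\<lambda>(k, a). (k, a + 1)) m_as = n_as" "map fst m_as = map fst n_as"
    by (auto simp: m_as_def comp_def case_prod_unfold)
  have "jordan_matrix n_as = 1\<^sub>m n + jordan_matrix m_as"
    using jordan_matrix_shift[of m_as] by (simp add: m n)
  moreover have "jordan_matrix m_as \<in> carrier_mat n n"
    using jordan_matrix_carrier[of m_as] by (simp only: m n)
  ultimately have "jordan_matrix n_as - 1\<^sub>m n = jordan_matrix m_as" by (intro eq_matI) auto
  then have "jordan_matrix m_as ^\<^sub>m r = 0\<^sub>m n n" using r by simp
  from nilpotent_jordan_matrixD[OF this] have "a - 1 = 0" if "(k, a) \<in> set n_as" for k a
    using that nz by (force simp: m_as_def)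
  then have "map (\<lambda>p. (fst p, 1)) n_as = n_as" by (intro map_idI) force
  then show ?thesis by (simp add: comp_def)
qed

lemma unipotent_unipotent_jordan_matrix:
  "unipotent_mat (sum_list ns) (unipotent_jordan_matrix ns :: 'a :: field mat)"
proof -
  define r where "r = Max (set (0 # ns))"
  have "\<forall>n \<in> set ns. n \<le> r" by (auto simp: r_def)
  from nilpotent_jordan_matrix_pow[OF this, where 'a = 'a]
  have "(nilpotent_jordan_matrix ns :: 'a mat) ^\<^sub>m r = 0\<^sub>m (sum_list ns) (sum_list ns)" .
  moreover have "unipotent_jordan_matrix ns - 1\<^sub>m (sum_list ns) = (nilpotent_jordan_matrix ns :: 'a mat)"
    unfolding unipotent_jordan_matrix_eq using nilpotent_jordan_matrix_carrier[of ns, where 'a = 'a]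
    by (intro eq_matI) (auto simp del: nilpotent_jordan_matrix_carrier)
  ultimately show ?thesis by (auto simp: unipotent_mat_def)
qed

section \<open>Reduction of strongly real unipotent classes\<close>

lemma (in group) strongly_real_conjugate:
  assumes g: "strongly_real G g" and u: "u \<in> carrier G"
  shows "strongly_real G (u \<otimes> g \<otimes> inv u)"
proof -
  obtain s where s: "s \<in> carrier G" "s \<otimes> s = \<one>" "s \<otimes> g \<otimes> s = inv g" and gG: "g \<in> carrier G"
    using g by (auto simp: strongly_real_def)
  have conj: "(u \<otimes> a \<otimes> inv u) \<otimes> (u \<otimes> b \<otimes> inv u) = u \<otimes> (a \<otimes> b) \<otimes> inv u"
    if "a \<in> carrier G" "b \<in> carrier G" for a b
    using that u by (simp add: m_assoc inv_solve_left')
  have "(u \<otimes> s \<otimes> inv u) \<otimes> (u \<otimes> s \<otimes> inv u) = \<one>"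
    using s u by (simp add: conj)
  moreover have "(u \<otimes> s \<otimes> inv u) \<otimes> (u \<otimes> g \<otimes> inv u) \<otimes> (u \<otimes> s \<otimes> inv u) = inv (u \<otimes> g \<otimes> inv u)"
    unfolding conj[OF s(1) gG] conj[OF m_closed[OF s(1) gG] s(1)] s(3)
    using gG u by (simp add: inv_mult_group m_assoc)
  ultimately show ?thesis
    using s(1) gG u unfolding strongly_real_def by (intro conjI bexI[of _ "u \<otimes> s \<otimes> inv u"]) auto
qed

lemma adjoint_zero_one:
  assumes "zero_one_mat (A :: 'a :: finite_field mat)" "q > 0"
  shows "adjoint q A = transpose_mat A"
proof (rule eq_matI)
  fix i j assume ij: "i < dim_row (transpose_mat A)" "j < dim_col (transpose_mat A)"
  then have "A $$ (j, i) = 0 \<or> A $$ (j, i) = 1" using assms(1) by (auto simp: zero_one_mat_def)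
  then show "adjoint q A $$ (i, j) = transpose_mat A $$ (i, j)"
    using ij assms(2) by (auto simp: adjoint_def bar_mat_def)
qed (auto simp: adjoint_def bar_mat_def)

lemma zero_one_unipotent_jordan_matrix: "zero_one_mat (unipotent_jordan_matrix ns :: 'a :: comm_ring_1 mat)"
proof (induction ns)
  case Nil
  then show ?case by (simp add: zero_one_mat_def unipotent_jordan_matrix_def jordan_matrix_def)
next
  case (Cons n ns)
  have "zero_one_mat (jordan_block n (1 :: 'a))" by (auto simp: zero_one_mat_def)
  then show ?case
    using zero_one_direct_sum[OF _ Cons] by (simp add: unipotent_jordan_matrix_def jordan_matrix_Cons)
qed

context quadratic_finite_field
begin

text \<open>The second description forgets the eigenvalues, which for a unipotent matrix are all 1.\<close>

lemma unipotent_class_iff: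
  "g \<in> unipotent_class q n \<mu> \<longleftrightarrow> g \<in> carrier (unitary_group q n) \<and>
     (\<exists>ns. mset ns = \<mu> \<and> 0 \<notin># \<mu> \<and> similar_mat g (unipotent_jordan_matrix ns :: 'a mat))"
proof
  assume g: "g \<in> unipotent_class q n \<mu>"
  then obtain n_as where n_as: "jordan_nf g n_as" "image_mset fst (mset n_as) = \<mu>"
    by (auto simp: unipotent_class_def)
  have "n_as = map (\<lambda>k. (k, 1)) (map fst n_as)"
    using jordan_nf_unipotent[OF _ _ n_as(1)] g by (auto simp: unipotent_class_def mem_unitary_group)
  then have "unipotent_jordan_matrix (map fst n_as) = jordan_matrix n_as"
    by (simp add: unipotent_jordan_matrix_def)
  then show "g \<in> carrier (unitary_group q n) \<and>
     (\<exists>ns. mset ns = \<mu> \<and> 0 \<notin># \<mu> \<and> similar_mat g (unipotent_jordan_matrix ns))"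
    using g n_as by (intro conjI exI[of _ "map fst n_as"]) (auto simp: unipotent_class_def jordan_nf_def)
next
  assume "g \<in> carrier (unitary_group q n) \<and>
     (\<exists>ns. mset ns = \<mu> \<and> 0 \<notin># \<mu> \<and> similar_mat g (unipotent_jordan_matrix ns :: 'a mat))"
  then obtain ns where g: "g \<in> carrier (unitary_group q n)" and ns: "mset ns = \<mu>" "0 \<notin># \<mu>"
    and sim: "similar_mat g (unipotent_jordan_matrix ns :: 'a mat)" by blast
  have gC: "g \<in> carrier_mat n n" using g by (simp add: mem_unitary_group)
  have "unipotent_jordan_matrix ns \<in> (carrier_mat n n :: 'a mat set)"
    using similar_matD[OF sim] gC by auto
  then have n: "n = sum_list ns"
    using unipotent_jordan_matrix_carrier[of ns, where 'a = 'a] by (metis carrier_matD(1))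
  have "unipotent_mat n g"
    using unipotent_mat_similar[OF gC sim] unipotent_unipotent_jordan_matrix[of ns, where 'a = 'a] by (simp add: n)
  moreover have "jordan_nf g (map (\<lambda>k. (k, 1)) ns)"
    using sim ns by (auto simp: jordan_nf_def unipotent_jordan_matrix_def)
  moreover have "image_mset fst (mset (map (\<lambda>k. (k, 1 :: 'a)) ns)) = \<mu>"
    using ns by (simp add: multiset.map_comp comp_def)
  ultimately show "g \<in> unipotent_class q n \<mu>" using g unfolding unipotent_class_def by blast
qed

text \<open>Unitary matrices of the same Jordan type are similar, hence conjugate in the unitary group.\<close>

lemma unipotent_class_conjugate:
  assumes g: "(g :: 'a mat) \<in> unipotent_class q n \<mu>"
  shows "unipotent_class q n \<mu> =
    {h \<otimes>\<^bsub>unitary_group q n\<^esub> g \<otimes>\<^bsub>unitary_group q n\<^esub> inv\<^bsub>unitary_group q n\<^esub> h | h. h \<in> carrier (unitary_group q n)}"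
    (is "?L = ?R")
proof (intro equalityI subsetI)
  interpret group "unitary_group q n :: 'a mat monoid" by (rule group_unitary)
  have gU: "g \<in> carrier (unitary_group q n)" using g by (simp add: unipotent_class_iff)
  obtain ns where ns: "mset ns = \<mu>" "0 \<notin># \<mu>" "similar_mat g (unipotent_jordan_matrix ns)"
    using g by (auto simp: unipotent_class_iff)
  {
    fix h assume "h \<in> ?L"
    then obtain ms where h: "h \<in> carrier (unitary_group q n)" and ms: "mset ms = \<mu>" "similar_mat h (unipotent_jordan_matrix ms)"
      by (auto simp: unipotent_class_iff)
    have "similar_mat (unipotent_jordan_matrix ms) (unipotent_jordan_matrix ns :: 'a mat)"
      unfolding unipotent_jordan_matrix_def
      by (rule jordan_matrix_similar_mset) (simp add: ms ns)
    then have "similar_mat h g"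
      using ms(2) ns(3) similar_mat_trans similar_mat_sym by blast
    then obtain u where u: "u \<in> carrier (unitary_group q n)" "h = u * g * adjoint q u"
      using unitary_similar_imp_conjugate[OF gU h] by blast
    then have "h = u \<otimes>\<^bsub>unitary_group q n\<^esub> g \<otimes>\<^bsub>unitary_group q n\<^esub> inv\<^bsub>unitary_group q n\<^esub> u"
      by (simp add: unitary_group_ops inv_unitary[OF u(1)])
    then show "h \<in> ?R" using u(1) by blast
  }
  fix h assume "h \<in> ?R"
  then obtain u where u: "u \<in> carrier (unitary_group q n)"
    and h: "h = u \<otimes>\<^bsub>unitary_group q n\<^esub> g \<otimes>\<^bsub>unitary_group q n\<^esub> inv\<^bsub>unitary_group q n\<^esub> u" by blast
  have "u * adjoint q u = 1\<^sub>m n" "adjoint q u * u = 1\<^sub>m n"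
    using r_inv[OF u] l_inv[OF u] by (simp_all add: unitary_group_ops inv_unitary[OF u])
  moreover have "u \<in> carrier_mat n n" "g \<in> carrier_mat n n" using u gU by (auto simp: mem_unitary_group)
  moreover have "h = u * g * adjoint q u" using h by (simp add: unitary_group_ops inv_unitary[OF u])
  ultimately have "similar_mat h g"
    by (intro similar_matI[of _ _ u "adjoint q u" n]) (auto intro!: mult_carrier_mat[of _ n n])
  then have "similar_mat h (unipotent_jordan_matrix ns)" using ns(3) similar_mat_trans by blast
  moreover have "h \<in> carrier (unitary_group q n)" using u gU h by simp
  ultimately show "h \<in> ?L" using ns by (auto simp: unipotent_class_iff)
qed

lemma strongly_real_classI:
  assumes g: "(g :: 'a mat) \<in> unipotent_class q n \<mu>" and sr: "strongly_real (unitary_group q n) g"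
  shows "strongly_real_class (unitary_group q n) (unipotent_class q n \<mu> :: 'a mat set)"
proof -
  interpret group "unitary_group q n :: 'a mat monoid" by (rule group_unitary)
  have "g \<in> carrier (unitary_group q n)" using g by (simp add: unipotent_class_iff)
  then show ?thesis
    unfolding strongly_real_class_def is_conjugacy_class_def unipotent_class_conjugate[OF g]
    using strongly_real_conjugate[OF sr] by blast
qed

text \<open>The form \<open>g * s * g = s\<close> of the inversion is free of inverses and is the one that compression preserves.\<close>

lemma strongly_real_iff:
  "strongly_real (unitary_group q n) (g :: 'a mat) \<longleftrightarrow> g \<in> carrier (unitary_group q n) \<and>
     (\<exists>s \<in> carrier (unitary_group q n). s * s = 1\<^sub>m n \<and> g * s * g = s)"
proof -
  interpret group "unitary_group q n :: 'a mat monoid" by (rule group_unitary)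
  have "s \<otimes>\<^bsub>unitary_group q n\<^esub> g \<otimes>\<^bsub>unitary_group q n\<^esub> s = inv\<^bsub>unitary_group q n\<^esub> g \<longleftrightarrow>
      g \<otimes>\<^bsub>unitary_group q n\<^esub> s \<otimes>\<^bsub>unitary_group q n\<^esub> g = s"
    if s: "s \<in> carrier (unitary_group q n)" "s \<otimes>\<^bsub>unitary_group q n\<^esub> s = \<one>\<^bsub>unitary_group q n\<^esub>"
      and g: "g \<in> carrier (unitary_group q n)" for s
  proof -
    have inv_s: "inv\<^bsub>unitary_group q n\<^esub> s = s" using s by (simp add: inv_equality)
    have "s \<otimes>\<^bsub>unitary_group q n\<^esub> g \<otimes>\<^bsub>unitary_group q n\<^esub> s = inv\<^bsub>unitary_group q n\<^esub> g \<longleftrightarrow>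
       g \<otimes>\<^bsub>unitary_group q n\<^esub> (s \<otimes>\<^bsub>unitary_group q n\<^esub> g \<otimes>\<^bsub>unitary_group q n\<^esub> s) = \<one>\<^bsub>unitary_group q n\<^esub>"
      using s g by (metis inv_equality inv_inv m_closed r_inv inv_closed)
    also have "\<dots> \<longleftrightarrow> (g \<otimes>\<^bsub>unitary_group q n\<^esub> s \<otimes>\<^bsub>unitary_group q n\<^esub> g) \<otimes>\<^bsub>unitary_group q n\<^esub> s = \<one>\<^bsub>unitary_group q n\<^esub>"
      using s g by (simp add: m_assoc)
    also have "\<dots> \<longleftrightarrow> g \<otimes>\<^bsub>unitary_group q n\<^esub> s \<otimes>\<^bsub>unitary_group q n\<^esub> g = s"
      using s g inv_s by (metis inv_equality m_closed inv_inv)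
    finally show ?thesis .
  qed
  then show ?thesis
    unfolding strongly_real_def by (auto simp: unitary_group_ops)
qed

text \<open>Everything is transported to the Jordan basis \<open>x\<close>: \<open>g\<close> becomes the Jordan matrix \<open>J\<close>, the standard
  form becomes the Gram matrix \<open>H = adjoint q x * x\<close> and \<open>s\<close> becomes \<open>S\<close>. All relations between these matrices survive
  compression, and since the compressed form is again non-degenerate and Hermitian, a base change \<open>y\<close> turns it
  into the standard form.\<close>

lemma ex_strongly_real_compression:
  fixes ns :: "nat list"
  assumes l: "2 \<le> l" and g: "strongly_real (unitary_group q n) (g :: 'a mat)"
    and sim: "similar_mat g (unipotent_jordan_matrix ns)"
  defines "ms \<equiv> map (\<lambda>i. if l \<le> i then i - 2 else i) ns"
  shows "\<exists>g' :: 'a mat. strongly_real (unitary_group q (sum_list ms)) g' \<and>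
    similar_mat g' (unipotent_jordan_matrix ms)"
proof -
  define m where "m = sum_list ms"
  \<comment> \<open>the exponent in $A = \ker N \cap \mathrm{im}\, N^{l-1}$; it is positive because \<open>l \<ge> 2\<close>\<close>
  define r where "r = l - 1"
  have r: "1 \<le> r" "Suc r = l" using l by (auto simp: r_def)
  obtain s where s: "s \<in> carrier (unitary_group q n)" "s * s = 1\<^sub>m n" "g * s * g = s"
    and gU: "g \<in> carrier (unitary_group q n)"
    using g by (auto simp: strongly_real_iff)
  let ?C = "carrier_mat n n :: 'a mat set"
  note assoc = assoc_mult_mat[of _ n n _ n _ n] mult_carrier_mat[of _ n n _ n]
  have gC: "g \<in> ?C" "adjoint q g * g = 1\<^sub>m n" and sC: "s \<in> ?C" "adjoint q s * s = 1\<^sub>m n"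
    using gU s by (auto simp: mem_unitary_group)
  define J where "J = (unipotent_jordan_matrix ns :: 'a mat)"
  obtain x x' where "similar_mat_wit g J x x'" using sim by (auto simp: similar_mat_def J_def)
  from similar_mat_witD2[OF gC(1) this]
  have x: "x \<in> ?C" "x' \<in> ?C" "x * x' = 1\<^sub>m n" "x' * x = 1\<^sub>m n" and JC: "J \<in> ?C" and g_eq: "g = x * J * x'"
    by auto
  have n: "n = sum_list ns"
    using JC unipotent_jordan_matrix_carrier[of ns, where 'a = 'a] unfolding J_def by (metis carrier_matD(1))
  have gx: "g * x = x * J" unfolding g_eq using x JC by (simp add: assoc)
  obtain P E0 E2 where P01: "zero_one_mat P"
    and "core_compression n m r (nilpotent_jordan_matrix ns) P E0 E2 (nilpotent_jordan_matrix ms :: 'a mat)"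
    using ex_core_compression[OF r(1), of ns, where 'a = 'a] unfolding r(2) ms_def[symmetric] m_def[symmetric] n[symmetric] by blast
  then interpret core_compression n m r "nilpotent_jordan_matrix ns" P E0 E2 "nilpotent_jordan_matrix ms"
    by simp
  have J_eq: "1\<^sub>m n + nilpotent_jordan_matrix ns = J" by (simp add: J_def unipotent_jordan_matrix_eq n)
  define J' where "J' = (unipotent_jordan_matrix ms :: 'a mat)"
  have cJ: "Q * J * P = J'" using compress_J unfolding J_eq by (simp add: J'_def unipotent_jordan_matrix_eq m_def)
  have adjJ: "adjoint q J = transpose_mat J" "adjoint q J' = transpose_mat J'" and adjP: "adjoint q P = Q"
    unfolding J_def J'_def using P01 q_pos zero_one_unipotent_jordan_matrix adjoint_zero_one by blast+
  have adjx: "adjoint q x * adjoint q x' = 1\<^sub>m n"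
    using adjoint_mult[OF x(2,1)] x(4) by simp
  have adj_compress: "adjoint q (Q * X * P) = Q * adjoint q X * P" if "X \<in> ?C" for X
  proof -
    have "adjoint q (Q * X * P) = Q * adjoint q (Q * X)"
      using adjoint_mult[of "Q * X" m n P m] that carriers(1,2) by (simp add: adjP mult_carrier_mat[of _ m n])
    also have "adjoint q (Q * X) = adjoint q X * P"
      using adjoint_mult[OF carriers(2) that] adjP by (metis adjoint_adjoint)
    finally show ?thesis using that carriers(1,2) by (simp add: assoc_mult_mat[of _ m n _ n _ m])
  qed

  define S where "S = x' * s * x"
  have SC: "S \<in> ?C" using x sC by (simp add: S_def)
  have xS: "x * S = s * x"
  proof -
    have "x * S = (x * x') * (s * x)" unfolding S_def using x(1,2) sC(1) by (simp add: assoc)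
    then show ?thesis using x sC by simp
  qed
  have cancel: "A = B" if "x * A = x * B" "A \<in> ?C" "B \<in> ?C" for A B
  proof -
    have "(x' * x) * A = x' * (x * B)" using that(1,2) x(1,2) by (simp add: assoc)
    also have "\<dots> = (x' * x) * B" using that(3) x(1,2) by (simp add: assoc)
    finally show ?thesis using that x by simp
  qed
  have SS: "S * S = 1\<^sub>m n"
  proof (rule cancel)
    have "x * (S * S) = (x * S) * S" using x SC by (simp add: assoc)
    also have "\<dots> = (s * x) * S" by (simp only: xS)
    also have "\<dots> = s * (x * S)" using x SC sC by (simp add: assoc)
    also have "\<dots> = (s * s) * x" unfolding xS using x sC by (simp add: assoc)
    finally show "x * (S * S) = x * 1\<^sub>m n" using s(2) x by simp
  qed (use SC in auto)
  have JSJ: "J * S * J = S"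
  proof (rule cancel)
    have "x * (J * S * J) = (x * J) * (S * J)" using x JC SC by (simp add: assoc)
    also have "\<dots> = g * ((x * S) * J)" unfolding gx[symmetric] using x gC JC SC by (simp add: assoc)
    also have "\<dots> = g * s * (x * J)" unfolding xS using x gC JC sC by (simp add: assoc)
    also have "\<dots> = (g * s * g) * x" unfolding gx[symmetric] using x gC sC by (simp add: assoc)
    finally show "x * (J * S * J) = x * S" by (simp only: s(3) xS)
  qed (use SC JC in \<open>auto simp: assoc\<close>)

  \<comment> \<open>the Gram matrix of the standard form in the Jordan basis, and its inverse\<close>
  define H where "H = adjoint q x * x"
  define K where "K = x' * adjoint q x'"
  have HC: "H \<in> ?C" "K \<in> ?C" using x by (auto simp: H_def K_def mult_carrier_mat[of _ n n])
  have HK: "H * K = 1\<^sub>m n"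
    unfolding H_def K_def using mult_cancel_middle[of "adjoint q x" n x x' "adjoint q x'"] x adjx by simp
  have adjH: "adjoint q H = H" unfolding H_def using x by (simp add: adjoint_mult[of _ n n _ n])
  have isom: "adjoint q A * H * A = H" if "A \<in> ?C" "b \<in> ?C" "adjoint q b * b = 1\<^sub>m n" "x * A = b * x" for A b
  proof -
    have "adjoint q A * H * A = adjoint q (x * A) * (x * A)"
      unfolding H_def using x(1) that(1) by (simp add: adjoint_mult[of _ n n _ n] assoc)
    also have "\<dots> = (adjoint q x * adjoint q b) * (b * x)"
      unfolding that(4) using x(1) that(2) by (simp add: adjoint_mult[of _ n n _ n])
    also have "\<dots> = H"
      unfolding H_def using mult_cancel_middle[of "adjoint q x" n "adjoint q b" b x] x(1) that(2,3) by simp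
    finally show ?thesis .
  qed
  have JHJ: "transpose_mat J * H * J = H" using isom[OF JC gC gx[symmetric]] by (simp add: adjJ)
  have SHS: "adjoint q S * H * S = H" using isom[OF SC sC xS] .
  have adjSC: "adjoint q S \<in> ?C" using SC by simp
  have JadjSJ: "transpose_mat J * adjoint q S * transpose_mat J = adjoint q S"
  proof -
    have "adjoint q (J * S * J) = adjoint q J * (adjoint q S * adjoint q J)"
      using JC SC by (simp add: adjoint_mult[of _ n n _ n] assoc)
    then show ?thesis using JC SC by (simp add: JSJ adjJ assoc)
  qed

  define H' where "H' = Q * H * P"
  define S' where "S' = Q * S * P"
  have C': "J' \<in> carrier_mat m m" "H' \<in> carrier_mat m m" "S' \<in> carrier_mat m m" "Q * K * P \<in> carrier_mat m m"
    using compress_carrier HC SC JC by (auto simp: H'_def S'_def simp flip: cJ)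
  have JS'J: "J' * S' * J' = S'"
    using compress_inverting[OF SC] unfolding J_eq cJ S'_def using JSJ by blast
  have S'S': "S' * S' = 1\<^sub>m m"
    using compress_involution[OF SC] unfolding J_eq S'_def using JSJ SS by blast
  have JH'J: "adjoint q J' * H' * J' = H'"
    using compress_unipotent_isometry[OF HC(1)] unfolding J_eq cJ H'_def adjJ using JHJ by blast
  have SH'S: "adjoint q S' * H' * S' = H'"
    using compress_isometry[OF HC(1) _ SC _ adjSC] unfolding J_eq H'_def S'_def adj_compress[OF SC]
    using JHJ JSJ JadjSJ SHS by blast
  have H'K': "H' * (Q * K * P) = 1\<^sub>m m"
    using compress_form_inverse[OF HC(1) _ HC(2) HK] unfolding J_eq H'_def using JHJ by blast
  have adjH': "adjoint q H' = H'" unfolding H'_def adj_compress[OF HC(1)] adjH ..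

  obtain y z where y: "y \<in> carrier_mat m m" "z \<in> carrier_mat m m" "y * z = 1\<^sub>m m" "z * y = 1\<^sub>m m"
    "adjoint q y * y = H'"
    using hermitian_eq_adjoint_mult[OF C'(2) adjH' C'(4) H'K'] by blast
  note assoc' = assoc_mult_mat[of _ m m _ m _ m] mult_carrier_mat[of _ m m _ m]
  have unitary: "y * A * z \<in> carrier (unitary_group q m)"
    if A: "A \<in> carrier_mat m m" "adjoint q A * H' * A = H'" for A
  proof -
    have "adjoint q (y * A * z) * (y * A * z) = adjoint q z * (adjoint q A * (adjoint q y * y) * A) * z"
      using y(1,2) A(1) by (simp add: adjoint_mult[of _ m m _ m] assoc')
    also have "\<dots> = adjoint q z * (adjoint q y * y) * z" by (simp only: y(5) A(2))
    also have "\<dots> = adjoint q (y * z) * (y * z)"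
      using y(1,2) by (simp add: adjoint_mult[of _ m m _ m] assoc')
    finally show ?thesis using y A by (simp add: mem_unitary_group)
  qed
  have conj: "(y * A * z) * (y * B * z) = y * (A * B) * z" if "A \<in> carrier_mat m m" "B \<in> carrier_mat m m" for A B
  proof -
    have "(y * A * z) * (y * B * z) = y * A * (z * y) * (B * z)"
      using y(1,2) that by (simp add: assoc')
    then show ?thesis unfolding y(4) using y(1,2) that by (simp add: assoc')
  qed
  have JS'C: "J' * S' \<in> carrier_mat m m" using C' by simp
  have "(y * S' * z) * (y * S' * z) = 1\<^sub>m m"
    unfolding conj[OF C'(3,3)] S'S' using y by simp
  moreover have "(y * J' * z) * (y * S' * z) * (y * J' * z) = y * S' * z"
    unfolding conj[OF C'(1,3)] conj[OF JS'C C'(1)] JS'J ..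
  ultimately have "strongly_real (unitary_group q m) (y * J' * z)"
    unfolding strongly_real_iff using unitary[OF C'(1) JH'J] unitary[OF C'(3) SH'S] by blast
  moreover have "similar_mat (y * J' * z) J'"
    using y C'(1) by (intro similar_matI[of _ _ y z m]) auto
  ultimately show ?thesis unfolding m_def[symmetric] J'_def by blast
qed

end

theorem proposition4p1:
  fixes q n k l :: nat and \<mu> :: "nat multiset"
  assumes "primepow q"
    and "card (UNIV :: 'a :: finite_field set) = q\<^sup>2"
    and "is_partition n \<mu>"
    and "k \<in># \<mu>" and "\<forall>i \<in># \<mu>. i \<le> k"
    and "2 \<le> l" and "l \<le> k" and "count \<mu> l > 0"
    and "strongly_real_class (unitary_group q n :: 'a mat monoid) (unipotent_class q n \<mu>)"
  shows "let n' = n - 2 * (\<Sum>l' = l..k. count \<mu> l') in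
           strongly_real_class (unitary_group q n' :: 'a mat monoid)
             (unipotent_class q n' (partition_sharp l \<mu>))"
proof -
  interpret quadratic_finite_field q "TYPE('a)" by unfold_locales (use assms(1,2) in auto)
  define n' where "n' = n - 2 * (\<Sum>l' = l..k. count \<mu> l')"
  obtain g :: "'a mat" where g: "g \<in> unipotent_class q n \<mu>" "strongly_real (unitary_group q n) g"
  proof -
    interpret group "unitary_group q n :: 'a mat monoid" by (rule group_unitary)
    obtain g :: "'a mat" where "g \<in> carrier (unitary_group q n)"
      "unipotent_class q n \<mu> = {h \<otimes>\<^bsub>unitary_group q n\<^esub> g \<otimes>\<^bsub>unitary_group q n\<^esub> inv\<^bsub>unitary_group q n\<^esub> h | h. h \<in> carrier (unitary_group q n)}"
      using assms(9) unfolding strongly_real_class_def is_conjugacy_class_def by blast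
    then have "g \<in> unipotent_class q n \<mu>" by (auto intro!: exI[of _ "\<one>\<^bsub>unitary_group q n\<^esub>"])
    with assms(9) that show thesis by (auto simp: strongly_real_class_def)
  qed
  obtain ns where ns: "mset ns = \<mu>" "similar_mat g (unipotent_jordan_matrix ns)"
    using g(1) by (auto simp: unipotent_class_iff)
  define ms where "ms = map (\<lambda>i. if l \<le> i then i - 2 else i) ns"
  obtain g' :: "'a mat" where g': "strongly_real (unitary_group q (sum_list ms)) g'"
    "similar_mat g' (unipotent_jordan_matrix ms)"
    using ex_strongly_real_compression[OF assms(6) g(2) ns(2)] unfolding ms_def by blast
  have sharp: "is_partition n' (partition_sharp l \<mu>)"
    unfolding n'_def using is_partition_sharp assms(3,5,6) by blast
  define ks where "ks = filter (\<lambda>i. 0 < i) ms"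
  have ks: "mset ks = partition_sharp l \<mu>"
    by (simp add: ks_def ms_def partition_sharp_def flip: ns(1))
  have "unipotent_jordan_matrix ks = (unipotent_jordan_matrix ms :: 'a mat)"
    using jordan_matrix_filter_nonzero[of "map (\<lambda>n. (n, 1 :: 'a)) ms"]
    by (simp add: unipotent_jordan_matrix_def ks_def filter_map comp_def)
  moreover have "sum_list ms = n'"
  proof -
    have "sum_list ms = sum_list ks" unfolding ks_def by (induction ms) auto
    also have "\<dots> = sum_mset (mset ks)" by (simp add: sum_mset_sum_list)
    finally show ?thesis using sharp by (simp add: ks is_partition_def)
  qed
  ultimately have "g' \<in> unipotent_class q n' (partition_sharp l \<mu>)" "strongly_real (unitary_group q n') g'"
    using g' ks sharp unfolding unipotent_class_iff strongly_real_def is_partition_def by auto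
  then show ?thesis unfolding Let_def n'_def[symmetric] by (rule strongly_real_classI)
qed

end
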